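(* Let $b_1,b_2>0$, let $A$ be the bounded self-adjoint operator on $l^2(\mathbb{Z}^* )$ and $R^{\pm}(\omega)$ the operators on $l^1(\mathbb{Z}^* )$ defined in the context, and let $I=[-4\max\{b_1^{-2},b_2^{-2}\},0]$. For any $\varphi\in l^1(\mathbb{Z}^* )$ and any $t\in\mathbb{R}$ the operator $\exp(itA)$ satisfies $$e^{itA}\varphi=\frac{1}{2i\pi}\int_I e^{it\omega}\,[R^{+}(\omega)-R^{-}(\omega)]\varphi\,d\omega,$$ where the identity is understood componentwise, i.e. at each $n\in\mathbb{Z}^*$.
   Context: $\mathbb{Z}^*=\mathbb{Z}\setminus\{0\}$, $Z_1=\mathbb{Z}\cap(-\infty,-1]$, $Z_2=\mathbb{Z}\cap[1,\infty)$. The operator $A$ acts on $f=(f(j))_{j\in\mathbb{Z}^*}$ by $(Af)(j)=b_1^{-2}(f(j+1)-2f(j)+f(j-1))$ for $j\le-2$; $(Af)(-1)=b_1^{-2}f(-2)-\big(b_1^{-2}+\frac1{b_1^2+b_2^2}\big)f(-1)+\frac1{b_1^2+b_2^2}f(1)$; $(Af)(1)=\frac1{b_1^2+b_2^2}f(-1)-\big(\frac1{b_1^2+b_2^2}+b_2^{-2}\big)f(1)+b_2^{-2}f(2)$; $(Af)(j)=b_2^{-2}(f(j+1)-2f(j)+f(j-1))$ for $j\ge2$. For $\omega\in I$, $\epsilon>0$ and $s\in\{1,2\}$, let $r_{s,\epsilon}^{\pm}$ be the unique solution with modulus less than one of $r^2-2r+1=(\omega\pm i\epsilon)b_s^2\,r$,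 and set $r_s^{\pm}=r_s^{\pm}(\omega)=\lim_{\epsilon\downarrow0}r_{s,\epsilon}^{\pm}$. These are roots of $r^2-2r+1=\omega b_s^2 r$ with $\mathrm{Im}(r_s^+)\le0\le\mathrm{Im}(r_s^-)$ and $r_s^-=\overline{r_s^+}$. For $\omega\in J=I\setminus\{-4b_1^{-2},-4b_2^{-2},0\}$ and $\varphi\in l^1(\mathbb{Z}^* )$ define, for $j\in Z_s$, $s\in\{1,2\}$, $$(R^{\pm}(\omega)\varphi)(j)=\frac{-(r_s^{\pm})^{|j|}}{b_2^{-2}(1-r_2^{\pm})+b_1^{-2}(1-r_1^{\pm})}\Big[\sum_{k\in Z_1}(r_1^{\pm})^{|k|}\varphi(k)+\sum_{k\in Z_2}(r_2^{\pm})^{|k|}\varphi(k)\Big]+\frac{b_s^2}{r_s^{\pm}-(r_s^{\pm})^{-1}}\sum_{k\in Z_s}\big((r_s^{\pm})^{|j-k|}-(r_s^{\pm})^{|j|+|k|}\big)\varphi(k).$$ The three excluded values of $\omega$ form a null set and do not affect the integral over $I$. *)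

theory Defs
  imports "HOL-Analysis.Analysis"
begin

section \<open>The Hilbert space of square summable sequences on the nonzero integers\<close>

abbreviation Zstar :: "int set" where "Zstar \<equiv> - {0}"

definition sq_summable :: "(int \<Rightarrow> complex) \<Rightarrow> bool" where
  "sq_summable f \<longleftrightarrow> (\<lambda>j. (cmod (f j))\<^sup>2) summable_on UNIV"

lemma sq_summable_comparison:
  assumes "g summable_on (UNIV :: int set)" "\<And>j. (cmod (f j))\<^sup>2 \<le> g j"
  shows "sq_summable f"
  unfolding sq_summable_def
  by (rule summable_on_comparison_test[OF assms(1)]) (use assms(2) in auto)

lemma sq_summable_add:
  assumes "sq_summable f" "sq_summable g"
  shows "sq_summable (\<lambda>j. f j + g j)"
proof (rule sq_summable_comparison)
  show "(\<lambda>j. 2 * (cmod (f j))\<^sup>2 + 2 * (cmod (g j))\<^sup>2) summable_on UNIV"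
    using assms unfolding sq_summable_def
    by (intro summable_on_add summable_on_cmult_right)
  fix j
  have "(cmod (f j + g j))\<^sup>2 \<le> (cmod (f j) + cmod (g j))\<^sup>2"
    by (intro power_mono norm_triangle_ineq) auto
  also have "\<dots> \<le> 2 * (cmod (f j))\<^sup>2 + 2 * (cmod (g j))\<^sup>2"
    using zero_le_power2[of "cmod (f j) - cmod (g j)"]
    by (simp add: power2_eq_square algebra_simps)
  finally show "(cmod (f j + g j))\<^sup>2 \<le> 2 * (cmod (f j))\<^sup>2 + 2 * (cmod (g j))\<^sup>2" .
qed

lemma sq_summable_cmult:
  assumes "sq_summable f"
  shows "sq_summable (\<lambda>j. c * f j)"
proof -
  have "(\<lambda>j. (cmod c)\<^sup>2 * (cmod (f j))\<^sup>2) summable_on UNIV"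
    using assms unfolding sq_summable_def by (intro summable_on_cmult_right)
  then show ?thesis
    by (simp add: sq_summable_def norm_mult power_mult_distrib)
qed

lemma sq_summable_shift:
  assumes "sq_summable f"
  shows "sq_summable (\<lambda>j. f (j + d))"
proof -
  have "bij_betw (\<lambda>j::int. j + d) UNIV UNIV"
    by (rule bij_betwI[where g = "\<lambda>j. j - d"]) auto
  from summable_on_reindex_bij_betw[OF this, of "\<lambda>j. (cmod (f j))\<^sup>2"] assms
  show ?thesis by (simp add: sq_summable_def)
qed

text \<open>
  A sequence indexed by the nonzero integers is represented by a function on all integers
  that takes the value 0 at 0.
\<close>

typedef ell2 = "{f :: int \<Rightarrow> complex. f 0 = 0 \<and> sq_summable f}"
  morphisms coord Abs_ell2
  by (rule exI[of _ "\<lambda>_. 0"]) (simp add: sq_summable_def)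

lemma coord_0 [simp]: "coord f 0 = 0"
  and sq_summable_coord: "sq_summable (coord f)"
  using coord[of f] by auto

lemma coord_Abs_ell2: "f 0 = 0 \<Longrightarrow> sq_summable f \<Longrightarrow> coord (Abs_ell2 f) = f"
  by (simp add: Abs_ell2_inverse)

lemma ell2_eqI: "(\<And>j. coord f j = coord g j) \<Longrightarrow> f = g"
  by (metis coord_inject ext)

instantiation ell2 :: real_vector
begin

definition zero_ell2 :: ell2 where "zero_ell2 = Abs_ell2 (\<lambda>_. 0)"
definition plus_ell2 :: "ell2 \<Rightarrow> ell2 \<Rightarrow> ell2" where
  "plus_ell2 f g = Abs_ell2 (\<lambda>j. coord f j + coord g j)"
definition scaleR_ell2 :: "real \<Rightarrow> ell2 \<Rightarrow> ell2" where
  "scaleR_ell2 c f = Abs_ell2 (\<lambda>j. complex_of_real c * coord f j)"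
definition uminus_ell2 :: "ell2 \<Rightarrow> ell2" where
  "uminus_ell2 f = (-1) *\<^sub>R f"
definition minus_ell2 :: "ell2 \<Rightarrow> ell2 \<Rightarrow> ell2" where
  "minus_ell2 f g = f + (- g)"

lemma coord_zero [simp]: "coord 0 j = 0"
  by (simp add: zero_ell2_def coord_Abs_ell2 sq_summable_def)

lemma coord_plus [simp]: "coord (f + g) j = coord f j + coord g j"
  by (simp add: plus_ell2_def coord_Abs_ell2 sq_summable_add sq_summable_coord)

lemma coord_scaleR [simp]: "coord (c *\<^sub>R f) j = complex_of_real c * coord f j"
  by (simp add: scaleR_ell2_def coord_Abs_ell2 sq_summable_cmult sq_summable_coord)

lemma coord_uminus [simp]: "coord (- f) j = - coord f j"
  by (simp add: uminus_ell2_def)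

lemma coord_minus [simp]: "coord (f - g) j = coord f j - coord g j"
  by (simp add: minus_ell2_def)

instance
  by standard (auto intro!: ell2_eqI simp: algebra_simps)

end

lemma sq_summable_inner:
  assumes "sq_summable f" "sq_summable g"
  shows "(\<lambda>j. f j \<bullet> g j) summable_on UNIV"
proof (rule abs_summable_summable, rule summable_on_comparison_test)
  show "(\<lambda>j. (cmod (f j))\<^sup>2 + (cmod (g j))\<^sup>2) summable_on UNIV"
    using assms unfolding sq_summable_def by (rule summable_on_add)
  fix j
  have "\<bar>f j \<bullet> g j\<bar> \<le> cmod (f j) * cmod (g j)"
    by (rule Cauchy_Schwarz_ineq2)
  also have "\<dots> \<le> (cmod (f j))\<^sup>2 + (cmod (g j))\<^sup>2"
    using zero_le_power2[of "cmod (f j) - cmod (g j)"]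
      mult_nonneg_nonneg[OF norm_ge_zero[of "f j"] norm_ge_zero[of "g j"]]
    unfolding power2_diff by linarith
  finally show "norm (f j \<bullet> g j) \<le> (cmod (f j))\<^sup>2 + (cmod (g j))\<^sup>2"
    by simp
qed auto

lemma coord_summable_inner: "(\<lambda>j. coord f j \<bullet> coord g j) summable_on UNIV"
  by (intro sq_summable_inner sq_summable_coord)

text \<open>
  The real inner product below is the real part of the usual complex inner product, hence it
  induces the usual norm.  Scalar multiplication by complex numbers is provided separately.
\<close>

instantiation ell2 :: real_inner
begin

definition inner_ell2 :: "ell2 \<Rightarrow> ell2 \<Rightarrow> real" where
  "inner_ell2 f g = (\<Sum>\<^sub>\<infinity>j. coord f j \<bullet> coord g j)"
definition norm_ell2 :: "ell2 \<Rightarrow> real" where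
  "norm_ell2 f = sqrt (f \<bullet> f)"
definition dist_ell2 :: "ell2 \<Rightarrow> ell2 \<Rightarrow> real" where
  "dist_ell2 f g = norm (f - g)"
definition sgn_ell2 :: "ell2 \<Rightarrow> ell2" where
  "sgn_ell2 f = inverse (norm f) *\<^sub>R f"
definition uniformity_ell2 :: "(ell2 \<times> ell2) filter" where
  "uniformity_ell2 = (INF e\<in>{0<..}. principal {(f, g). dist f g < e})"
definition open_ell2 :: "ell2 set \<Rightarrow> bool" where
  "open_ell2 U = (\<forall>x\<in>U. \<forall>\<^sub>F (x', y) in uniformity. x' = x \<longrightarrow> y \<in> U)"

instance
proof
  fix f g h :: ell2 and c :: real
  show "f \<bullet> g = g \<bullet> f"
    by (simp add: inner_ell2_def inner_commute)
  show "(f + g) \<bullet> h = f \<bullet> h + g \<bullet> h"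
    by (simp add: inner_ell2_def inner_add_left infsum_add coord_summable_inner)
  show "(c *\<^sub>R f) \<bullet> g = c * (f \<bullet> g)"
    using inner_scaleR_left[where 'a = complex]
    by (simp add: inner_ell2_def infsum_cmult_right coord_summable_inner
        flip: scaleR_conv_of_real)
  show "0 \<le> f \<bullet> f"
    by (simp add: inner_ell2_def infsum_nonneg)
  show "(f \<bullet> f = 0) = (f = 0)"
  proof
    assume "f \<bullet> f = 0"
    then have "coord f j \<bullet> coord f j = 0" for j
      using nonneg_infsum_le_0D[of "\<lambda>j. coord f j \<bullet> coord f j" UNIV j]
        coord_summable_inner[of f f]
      by (simp add: inner_ell2_def)
    then show "f = 0" by (intro ell2_eqI) simp
  qed (simp add: inner_ell2_def)
qed (simp_all add: norm_ell2_def dist_ell2_def sgn_ell2_def uniformity_ell2_def open_ell2_def)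

end

lemma norm_ell2_sq: "(norm (f :: ell2))\<^sup>2 = (\<Sum>\<^sub>\<infinity>j. (cmod (coord f j))\<^sup>2)"
  unfolding power2_norm_eq_inner inner_ell2_def by simp

lemma sum_le_norm_ell2_sq:
  assumes "finite F"
  shows "(\<Sum>j\<in>F. (cmod (coord f j))\<^sup>2) \<le> (norm f)\<^sup>2"
  unfolding norm_ell2_sq
  by (rule finite_sum_le_infsum)
     (use assms sq_summable_coord[of f] in \<open>auto simp: sq_summable_def\<close>)

lemma cmod_coord_le: "cmod (coord f j) \<le> norm f"
  using sum_le_norm_ell2_sq[of "{j}" f] by (simp add: abs_le_square_iff[symmetric])

lemma norm_ell2_leI:
  assumes "\<And>F. finite F \<Longrightarrow> (\<Sum>j\<in>F. (cmod (coord f j))\<^sup>2) \<le> B\<^sup>2" "0 \<le> B"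
  shows "norm f \<le> B"
proof -
  have "(norm f)\<^sup>2 \<le> B\<^sup>2"
    unfolding norm_ell2_sq
    by (rule infsum_le_finite_sums)
       (use assms sq_summable_coord[of f] in \<open>auto simp: sq_summable_def\<close>)
  then show ?thesis using assms(2) by (rule power2_le_imp_le)
qed

instance ell2 :: banach
proof
  fix X :: "nat \<Rightarrow> ell2"
  assume X: "Cauchy X"
  have "Cauchy (\<lambda>n. coord (X n) j)" for j
  proof (rule metric_CauchyI)
    fix e :: real assume "e > 0"
    then obtain M where M: "\<And>m n. m \<ge> M \<Longrightarrow> n \<ge> M \<Longrightarrow> dist (X m) (X n) < e"
      using X metric_CauchyD by metis
    have "dist (coord (X m) j) (coord (X n) j) \<le> dist (X m) (X n)" for m n
      using cmod_coord_le[of "X m - X n" j] by (simp add: dist_norm)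
    then show "\<exists>M. \<forall>m\<ge>M. \<forall>n\<ge>M. dist (coord (X m) j) (coord (X n) j) < e"
      using M by (meson le_less_trans)
  qed
  then have "\<exists>l. (\<lambda>n. coord (X n) j) \<longlonglongrightarrow> l" for j
    by (simp add: Cauchy_convergent_iff convergent_def)
  then obtain f where f: "\<And>j. (\<lambda>n. coord (X n) j) \<longlonglongrightarrow> f j" by metis
  have f0: "f 0 = 0" using f[of 0] by (simp add: LIMSEQ_const_iff)
  have bnd: "\<exists>M. \<forall>n\<ge>M. \<forall>F. finite F \<longrightarrow> (\<Sum>j\<in>F. (cmod (coord (X n) j - f j))\<^sup>2) \<le> e\<^sup>2"
    if "e > 0" for e :: real
  proof -
    obtain M where M: "\<And>m n. m \<ge> M \<Longrightarrow> n \<ge> M \<Longrightarrow> dist (X m) (X n) < e"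
      using X \<open>e > 0\<close> metric_CauchyD by metis
    have "(\<Sum>j\<in>F. (cmod (coord (X n) j - f j))\<^sup>2) \<le> e\<^sup>2" if "n \<ge> M" "finite F" for n F
    proof (rule LIMSEQ_le_const2)
      show "(\<lambda>m. \<Sum>j\<in>F. (cmod (coord (X n) j - coord (X m) j))\<^sup>2)
              \<longlonglongrightarrow> (\<Sum>j\<in>F. (cmod (coord (X n) j - f j))\<^sup>2)"
        by (intro tendsto_intros f)
      have "(\<Sum>j\<in>F. (cmod (coord (X n) j - coord (X m) j))\<^sup>2) \<le> e\<^sup>2" if "m \<ge> M" for m
      proof -
        have "(\<Sum>j\<in>F. (cmod (coord (X n) j - coord (X m) j))\<^sup>2) \<le> (norm (X n - X m))\<^sup>2"
          using sum_le_norm_ell2_sq[OF \<open>finite F\<close>, of "X n - X m"] by simp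
        also have "\<dots> \<le> e\<^sup>2"
          using M[OF \<open>n \<ge> M\<close> that] by (intro power_mono) (auto simp: dist_norm)
        finally show ?thesis .
      qed
      then show "\<exists>N. \<forall>m\<ge>N. (\<Sum>j\<in>F. (cmod (coord (X n) j - coord (X m) j))\<^sup>2) \<le> e\<^sup>2"
        by blast
    qed
    then show ?thesis by blast
  qed
  from bnd[of 1] obtain N where
    N: "\<And>F. finite F \<Longrightarrow> (\<Sum>j\<in>F. (cmod (coord (X N) j - f j))\<^sup>2) \<le> 1" by fastforce
  have "sq_summable (\<lambda>j. coord (X N) j - f j)"
    unfolding sq_summable_def
    by (rule nonneg_bdd_above_summable_on) (use N in \<open>auto intro!: bdd_aboveI2[where M = 1]\<close>)
  from sq_summable_add[OF sq_summable_cmult[OF this, of "-1"] sq_summable_coord[of "X N"]]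
  have "sq_summable f" by simp
  with f0 have cf: "coord (Abs_ell2 f) = f" by (rule coord_Abs_ell2)
  have "X \<longlonglongrightarrow> Abs_ell2 f"
  proof (rule metric_LIMSEQ_I)
    fix e :: real assume "e > 0"
    with bnd[of "e/2"] obtain M where
      M: "\<And>n F. n \<ge> M \<Longrightarrow> finite F \<Longrightarrow> (\<Sum>j\<in>F. (cmod (coord (X n) j - f j))\<^sup>2) \<le> (e/2)\<^sup>2"
      by (metis half_gt_zero)
    have "norm (X n - Abs_ell2 f) \<le> e/2" if "n \<ge> M" for n
      by (rule norm_ell2_leI) (use M[OF that] \<open>e > 0\<close> in \<open>auto simp: cf\<close>)
    then show "\<exists>M. \<forall>n\<ge>M. dist (X n) (Abs_ell2 f) < e"
      using \<open>e > 0\<close> by (intro exI[of _ M]) (fastforce simp: dist_norm)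
  qed
  then show "convergent X" by (auto simp: convergent_def)
qed

text \<open>The element given by an arbitrary sequence; the value at 0 is irrelevant.\<close>

definition to_ell2 :: "(int \<Rightarrow> complex) \<Rightarrow> ell2" where
  "to_ell2 \<phi> = Abs_ell2 (\<lambda>j. if j = 0 then 0 else \<phi> j)"

lemma coord_to_ell2:
  assumes "(\<lambda>k. cmod (\<phi> k)) summable_on Zstar" "j \<in> Zstar"
  shows "coord (to_ell2 \<phi>) j = \<phi> j"
proof -
  let ?g = "\<lambda>j. if j = 0 then 0 else \<phi> j"
  define B where "B = (\<Sum>\<^sub>\<infinity>k\<in>Zstar. norm (\<phi> k))"
  have le: "norm (\<phi> k) \<le> B" if "k \<in> Zstar" for k
    using finite_sum_le_infsum[OF assms(1), of "{k}"] that by (simp add: B_def)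
  have "(\<lambda>k. B * norm (?g k)) summable_on UNIV"
    using assms(1) by (intro summable_on_cmult_right)
      (subst summable_on_cong_neutral[where T = Zstar and g = "\<lambda>k. norm (\<phi> k)"], auto)
  then have "sq_summable ?g"
    by (rule sq_summable_comparison)
       (use le in \<open>auto simp: power2_eq_square intro!: mult_right_mono\<close>)
  then show ?thesis using assms(2) by (simp add: to_ell2_def coord_Abs_ell2)
qed


section \<open>Complex multiples and exponentials of bounded operators\<close>

lemma bounded_linear_cmult_ell2:
  "bounded_linear (\<lambda>f. Abs_ell2 (\<lambda>j. c * coord f j))"
  and coord_cmult_ell2: "coord (Abs_ell2 (\<lambda>j. c * coord f j)) j = c * coord f j"
proof -
  have c: "coord (Abs_ell2 (\<lambda>j. c * coord f j)) j = c * coord f j" for f j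
    by (simp add: coord_Abs_ell2 sq_summable_cmult sq_summable_coord)
  then show "coord (Abs_ell2 (\<lambda>j. c * coord f j)) j = c * coord f j" .
  show "bounded_linear (\<lambda>f. Abs_ell2 (\<lambda>j. c * coord f j))"
  proof (rule bounded_linear_intro[where K = "cmod c"])
    fix f
    have "(\<Sum>j\<in>F. (cmod (c * coord f j))\<^sup>2) \<le> (norm f * cmod c)\<^sup>2" if "finite F" for F
      using mult_right_mono[OF sum_le_norm_ell2_sq[OF that, of f], of "(cmod c)\<^sup>2"]
      by (simp add: norm_mult power_mult_distrib sum_distrib_left mult.commute)
    then show "norm (Abs_ell2 (\<lambda>j. c * coord f j)) \<le> norm f * cmod c"
      by (intro norm_ell2_leI) (auto simp: c)
    next
    fix f g :: ell2 and r :: real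
    show "Abs_ell2 (\<lambda>j. c * coord (f + g) j)
        = Abs_ell2 (\<lambda>j. c * coord f j) + Abs_ell2 (\<lambda>j. c * coord g j)"
      by (rule ell2_eqI, unfold coord_plus[of "Abs_ell2 _"] c) (simp add: algebra_simps)
    show "Abs_ell2 (\<lambda>j. c * coord (r *\<^sub>R f) j) = r *\<^sub>R Abs_ell2 (\<lambda>j. c * coord f j)"
      by (rule ell2_eqI, unfold coord_scaleR[of _ "Abs_ell2 _"] c) (simp add: algebra_simps)
  qed
qed

lift_definition cmult_ell2 :: "complex \<Rightarrow> ell2 \<Rightarrow>\<^sub>L ell2"
  is "\<lambda>c f. Abs_ell2 (\<lambda>j. c * coord f j)"
  by (rule bounded_linear_cmult_ell2)

text \<open>The series converges in the operator norm.\<close>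

definition exp_blinfun :: "('a::banach \<Rightarrow>\<^sub>L 'a) \<Rightarrow> 'a \<Rightarrow>\<^sub>L 'a" where
  "exp_blinfun T = (\<Sum>n. (1 / fact n) *\<^sub>R (((o\<^sub>L) T ^^ n) id_blinfun))"

lemma summable_exp_blinfun:
  fixes T :: "'a::banach \<Rightarrow>\<^sub>L 'a"
  shows "summable (\<lambda>n. (1 / fact n) *\<^sub>R (((o\<^sub>L) T ^^ n) id_blinfun))"
proof (rule summable_comparison_test')
  show "summable (\<lambda>n. norm T ^ n /\<^sub>R fact n)"
    by (rule summable_exp_generic)
  have "norm (((o\<^sub>L) T ^^ n) id_blinfun) \<le> norm T ^ n" for n
  proof (induction n)
    case 0
    then show ?case by (simp add: norm_blinfun_id_le)
  next
    case (Suc n)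
    have "norm (((o\<^sub>L) T ^^ Suc n) id_blinfun) \<le> norm T * norm (((o\<^sub>L) T ^^ n) id_blinfun)"
      by (simp add: norm_blinfun_compose)
    also have "\<dots> \<le> norm T * norm T ^ n"
      by (intro mult_left_mono Suc.IH) auto
    finally show ?case by simp
  qed
  then show "norm ((1 / fact n) *\<^sub>R (((o\<^sub>L) T ^^ n) id_blinfun)) \<le> norm T ^ n /\<^sub>R fact n" for n
    by (simp add: divide_simps)
qed


section \<open>The operator \<open>A\<close>\<close>

definition A_seq :: "real \<Rightarrow> real \<Rightarrow> (int \<Rightarrow> complex) \<Rightarrow> int \<Rightarrow> complex" where
  "A_seq b1 b2 f j =
    (if j \<le> -2 then complex_of_real (1 / b1\<^sup>2) * (f (j + 1) - 2 * f j + f (j - 1))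
     else if j = -1 then
       complex_of_real (1 / b1\<^sup>2) * f (-2)
       - complex_of_real (1 / b1\<^sup>2 + 1 / (b1\<^sup>2 + b2\<^sup>2)) * f (-1)
       + complex_of_real (1 / (b1\<^sup>2 + b2\<^sup>2)) * f 1
     else if j = 1 then
       complex_of_real (1 / (b1\<^sup>2 + b2\<^sup>2)) * f (-1)
       - complex_of_real (1 / (b1\<^sup>2 + b2\<^sup>2) + 1 / b2\<^sup>2) * f 1
       + complex_of_real (1 / b2\<^sup>2) * f 2
     else if j \<ge> 2 then complex_of_real (1 / b2\<^sup>2) * (f (j + 1) - 2 * f j + f (j - 1))
     else 0)"

lemma A_seq_bound:
  obtains C where "0 \<le> C"
    "\<And>f j. cmod (A_seq b1 b2 f j) \<le> C * (\<Sum>d\<in>{-2..2}. cmod (f (j + d)))"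
proof
  define p q r where "p = 1 / b1\<^sup>2" and "q = 1 / b2\<^sup>2" and "r = 1 / (b1\<^sup>2 + b2\<^sup>2)"
  define C where "C = 4 * (p + q + r)"
  have pos: "p \<ge> 0" "q \<ge> 0" "r \<ge> 0" by (auto simp: p_def q_def r_def)
  then show "0 \<le> C" by (simp add: C_def)
  fix f :: "int \<Rightarrow> complex" and j :: int
  define S where "S = (\<Sum>d\<in>{-2..2}. cmod (f (j + d)))"
  have le: "cmod (f (j + d)) \<le> S" if "d \<in> {-2..2}" for d :: int
    unfolding S_def by (rule member_le_sum) (use that in auto)
  have S0: "0 \<le> S" by (simp add: S_def sum_nonneg)
  have three: "cmod (of_real x * u - of_real y * v + of_real z * w) \<le> (x + y + z) * S"
    if "x \<ge> 0" "y \<ge> 0" "z \<ge> 0" "cmod u \<le> S" "cmod v \<le> S" "cmod w \<le> S"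
    for x y z :: real and u v w
  proof -
    have "cmod (of_real x * u - of_real y * v + of_real z * w)
            \<le> x * cmod u + y * cmod v + z * cmod w"
      using norm_triangle_ineq[of "of_real x * u - of_real y * v" "of_real z * w"]
        norm_triangle_ineq4[of "of_real x * u" "of_real y * v"] that(1-3)
      by (simp add: norm_mult)
    also have "\<dots> \<le> x * S + y * S + z * S"
      by (intro add_mono mult_left_mono that)
    finally show ?thesis by (simp add: algebra_simps)
  qed
  have coef: "x * S \<le> C * S" if "x \<le> C" for x
    using that S0 by (rule mult_right_mono)
  consider "j \<le> -2" | "j = -1" | "j = 1" | "j \<ge> 2" | "j = 0" by linarith
  then show "cmod (A_seq b1 b2 f j) \<le> C * (\<Sum>d\<in>{-2..2}. cmod (f (j + d)))"
    unfolding S_def[symmetric]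
  proof cases
    case 1
    have "A_seq b1 b2 f j
            = of_real p * f (j + 1) - of_real (2 * p) * f (j + 0) + of_real p * f (j + (-1))"
      using 1 by (simp add: A_seq_def p_def algebra_simps)
    then show "cmod (A_seq b1 b2 f j) \<le> C * S"
      using three[of p "2 * p" p "f (j + 1)" "f (j + 0)" "f (j + (-1))"] coef[of "p + 2 * p + p"]
        le[of 1] le[of 0] le[of "-1"] pos by (simp add: C_def)
  next
    case 2
    have "A_seq b1 b2 f j
            = of_real p * f (j + (-1)) - of_real (p + r) * f (j + 0) + of_real r * f (j + 2)"
      using 2 by (simp add: A_seq_def p_def r_def)
    then show "cmod (A_seq b1 b2 f j) \<le> C * S"
      using three[of p "p + r" r "f (j + (-1))" "f (j + 0)" "f (j + 2)"]
        coef[of "p + (p + r) + r"] le[of 2] le[of 0] le[of "-1"] pos by (simp add: C_def)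
  next
    case 3
    have "A_seq b1 b2 f j
            = of_real r * f (j + (-2)) - of_real (r + q) * f (j + 0) + of_real q * f (j + 1)"
      using 3 by (simp add: A_seq_def q_def r_def)
    then show "cmod (A_seq b1 b2 f j) \<le> C * S"
      using three[of r "r + q" q "f (j + (-2))" "f (j + 0)" "f (j + 1)"]
        coef[of "r + (r + q) + q"] le[of "-2"] le[of 0] le[of 1] pos by (simp add: C_def)
  next
    case 4
    have "A_seq b1 b2 f j
            = of_real q * f (j + 1) - of_real (2 * q) * f (j + 0) + of_real q * f (j + (-1))"
      using 4 by (simp add: A_seq_def q_def algebra_simps)
    then show "cmod (A_seq b1 b2 f j) \<le> C * S"
      using three[of q "2 * q" q "f (j + 1)" "f (j + 0)" "f (j + (-1))"] coef[of "q + 2 * q + q"]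
        le[of 1] le[of 0] le[of "-1"] pos by (simp add: C_def)
  next
    case 5
    then show "cmod (A_seq b1 b2 f j) \<le> C * S"
      using S0 \<open>0 \<le> C\<close> by (simp add: A_seq_def)
  qed
qed

lemma A_seq_0 [simp]: "A_seq b1 b2 f 0 = 0"
  by (simp add: A_seq_def)

lemma A_seq_sq_bound:
  obtains C where "0 \<le> C"
    "\<And>f j. (cmod (A_seq b1 b2 f j))\<^sup>2 \<le> C * (\<Sum>d\<in>{-2..2}. (cmod (f (j + d)))\<^sup>2)"
proof -
  obtain C where C: "0 \<le> C"
    "\<And>f j. cmod (A_seq b1 b2 f j) \<le> C * (\<Sum>d\<in>{-2..2}. cmod (f (j + d)))"
    using A_seq_bound by blast
  have "(cmod (A_seq b1 b2 f j))\<^sup>2 \<le> (C\<^sup>2 * 5) * (\<Sum>d\<in>{-2..2}. (cmod (f (j + d)))\<^sup>2)" for f j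
  proof -
    have "(cmod (A_seq b1 b2 f j))\<^sup>2 \<le> (C * (\<Sum>d\<in>{-2..2}. cmod (f (j + d))))\<^sup>2"
      by (intro power_mono C) auto
    also have "\<dots> = C\<^sup>2 * (\<Sum>d\<in>{-2..2}. cmod (f (j + d)))\<^sup>2"
      by (simp add: power_mult_distrib)
    also have "\<dots> \<le> C\<^sup>2 * (5 * (\<Sum>d\<in>{-2..2}. (cmod (f (j + d)))\<^sup>2))"
      using sum_squared_le_sum_of_squares[of "\<lambda>d. cmod (f (j + d))" "{-2..2::int}"]
      by (intro mult_left_mono) auto
    finally show ?thesis by simp
  qed
  then show ?thesis using that[of "C\<^sup>2 * 5"] by auto
qed

lemma sq_summable_A_seq:
  assumes "sq_summable f"
  shows "sq_summable (A_seq b1 b2 f)"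
proof -
  obtain C where C: "0 \<le> C"
    "\<And>f j. (cmod (A_seq b1 b2 f j))\<^sup>2 \<le> C * (\<Sum>d\<in>{-2..2}. (cmod (f (j + d)))\<^sup>2)"
    using A_seq_sq_bound by blast
  have "(\<lambda>j. \<Sum>d\<in>D. (cmod (f (j + d)))\<^sup>2) summable_on UNIV" if "finite D" for D
    using that sq_summable_shift[OF assms]
    by induction (auto simp: sq_summable_def intro: summable_on_add)
  then show ?thesis
    by (intro sq_summable_comparison[OF _ C(2)] summable_on_cmult_right) auto
qed

lemma coord_Abs_A_seq: "coord (Abs_ell2 (A_seq b1 b2 (coord f))) = A_seq b1 b2 (coord f)"
  by (simp add: coord_Abs_ell2 sq_summable_A_seq sq_summable_coord)

lemma bounded_linear_A: "bounded_linear (\<lambda>f. Abs_ell2 (A_seq b1 b2 (coord f)))"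
proof -
  obtain C where C: "0 \<le> C"
    "\<And>f j. (cmod (A_seq b1 b2 f j))\<^sup>2 \<le> C * (\<Sum>d\<in>{-2..2}. (cmod (f (j + d)))\<^sup>2)"
    using A_seq_sq_bound by blast
  show ?thesis
  proof (rule bounded_linear_intro[where K = "sqrt (5 * C)"])
    fix f
    have "(\<Sum>j\<in>F. (cmod (A_seq b1 b2 (coord f) j))\<^sup>2) \<le> (norm f * sqrt (5 * C))\<^sup>2"
      if "finite F" for F
    proof -
      have "(\<Sum>j\<in>F. (cmod (A_seq b1 b2 (coord f) j))\<^sup>2)
              \<le> (\<Sum>j\<in>F. C * (\<Sum>d\<in>{-2..2}. (cmod (coord f (j + d)))\<^sup>2))"
        by (intro sum_mono C)
      also have "\<dots> = C * (\<Sum>d\<in>{-2..2}. \<Sum>j\<in>F. (cmod (coord f (j + d)))\<^sup>2)"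
        by (simp only: sum_distrib_left[symmetric] sum.swap[of _ _ F])
      also have "\<dots> \<le> C * (\<Sum>d\<in>{-2..2::int}. (norm f)\<^sup>2)"
      proof (intro mult_left_mono sum_mono C)
        fix d
        have "(\<Sum>j\<in>F. (cmod (coord f (j + d)))\<^sup>2) = (\<Sum>j\<in>(\<lambda>j. j + d) ` F. (cmod (coord f j))\<^sup>2)"
          by (subst sum.reindex) (auto simp: inj_on_def)
        also have "\<dots> \<le> (norm f)\<^sup>2" by (rule sum_le_norm_ell2_sq) (use that in simp)
        finally show "(\<Sum>j\<in>F. (cmod (coord f (j + d)))\<^sup>2) \<le> (norm f)\<^sup>2" .
      qed
      also have "\<dots> = (norm f * sqrt (5 * C))\<^sup>2"
        using C(1) by (simp add: power_mult_distrib)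
      finally show ?thesis .
    qed
    then show "norm (Abs_ell2 (A_seq b1 b2 (coord f))) \<le> norm f * sqrt (5 * C)"
      using C(1) by (intro norm_ell2_leI) (auto simp: coord_Abs_A_seq)
  qed (auto intro!: ell2_eqI simp: coord_Abs_A_seq A_seq_def algebra_simps add_divide_distrib)
qed

lift_definition A_op :: "real \<Rightarrow> real \<Rightarrow> ell2 \<Rightarrow>\<^sub>L ell2"
  is "\<lambda>b1 b2 f. Abs_ell2 (A_seq b1 b2 (coord f))"
  by (rule bounded_linear_A)

lemma coord_A_op: "coord (blinfun_apply (A_op b1 b2) f) = A_seq b1 b2 (coord f)"
  by (simp add: A_op.rep_eq coord_Abs_A_seq)


text \<open>
  The operator is complex linear and symmetric for the real part of the inner product,
  that is, self-adjoint for the complex inner product.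
\<close>

lemma A_op_cmult: "A_op b1 b2 o\<^sub>L cmult_ell2 c = cmult_ell2 c o\<^sub>L A_op b1 b2"
proof (rule blinfun_eqI, rule ell2_eqI)
  fix f j
  have "coord (blinfun_apply (cmult_ell2 c) g) = (\<lambda>j. c * coord g j)" for g
    by (simp add: fun_eq_iff cmult_ell2.rep_eq coord_cmult_ell2)
  then show "coord (blinfun_apply (A_op b1 b2 o\<^sub>L cmult_ell2 c) f) j
      = coord (blinfun_apply (cmult_ell2 c o\<^sub>L A_op b1 b2) f) j"
    by (simp add: coord_A_op A_seq_def algebra_simps add_divide_distrib)
qed

lemma summable_on_diff_real:
  fixes f g :: "int \<Rightarrow> real"
  assumes "f summable_on S" "g summable_on S"
  shows "(\<lambda>x. f x - g x) summable_on S"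
    and "(\<Sum>\<^sub>\<infinity>x\<in>S. f x - g x) = (\<Sum>\<^sub>\<infinity>x\<in>S. f x) - (\<Sum>\<^sub>\<infinity>x\<in>S. g x)"
  using summable_on_add[OF assms(1), of "\<lambda>x. - g x"] infsum_add[OF assms(1), of "\<lambda>x. - g x"]
    assms(2)
  by (simp_all add: summable_on_uminus infsum_uminus)

lemma A_op_self_adjoint: "blinfun_apply (A_op b1 b2) f \<bullet> g = f \<bullet> blinfun_apply (A_op b1 b2) g"
proof -
  define F G where "F = coord f" and "G = coord g"
  define V where "V = (\<lambda>d j. F (j + d) \<bullet> G j - F j \<bullet> G (j + d))"
  define W where "W = (\<lambda>j. if j \<le> -2 then 1 / b1\<^sup>2 * V 1 j
      else if j = -1 then 1 / (b1\<^sup>2 + b2\<^sup>2) * V 2 j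
      else if j = 0 then 1 / (b1\<^sup>2 + b2\<^sup>2) * V 2 (-1)
      else 1 / b2\<^sup>2 * V 1 j)"
  have sq: "sq_summable F" "sq_summable G" by (simp_all add: F_def G_def sq_summable_coord)
  have F0: "F 0 = 0" "G 0 = 0" by (simp_all add: F_def G_def)
  have V: "V d summable_on S" for d S
  proof (rule summable_on_subset_banach)
    show "V d summable_on UNIV"
      unfolding V_def by (intro summable_on_diff_real(1) sq_summable_inner sq_summable_shift sq)
  qed simp
  have "W summable_on {..-2} \<union> ({-1, 0} \<union> {1..})"
  proof (intro summable_on_Un_disjoint)
    show "W summable_on {..-2}"
      using summable_on_cmult_right[OF V, of "1 / b1\<^sup>2" 1]
      by (rule summable_on_cong[THEN iffD1, rotated]) (auto simp: W_def)
    show "W summable_on {1..}"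
      using summable_on_cmult_right[OF V, of "1 / b2\<^sup>2" 1]
      by (rule summable_on_cong[THEN iffD1, rotated]) (auto simp: W_def)
  qed auto
  also have "{..-2} \<union> ({-1, 0} \<union> {1..}) = (UNIV :: int set)" by auto
  finally have W: "W summable_on UNIV" .
  have bij: "bij_betw (\<lambda>j::int. j - 1) UNIV UNIV"
    by (rule bij_betwI[where g = "\<lambda>j. j + 1"]) auto
  have W': "(\<lambda>j. W (j - 1)) summable_on UNIV"
    using W summable_on_reindex_bij_betw[OF bij] by blast
  have eq: "A_seq b1 b2 F j \<bullet> G j - F j \<bullet> A_seq b1 b2 G j = W j - W (j - 1)" for j
  proof -
    have m: "(complex_of_real c * z) \<bullet> w = c * (z \<bullet> w)" "w \<bullet> (complex_of_real c * z) = c * (w \<bullet> z)"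
      for c z w
      by (simp_all flip: scaleR_conv_of_real)
    have two: "(2 * z) \<bullet> w = 2 * (z \<bullet> w)" "w \<bullet> (2 * z) = 2 * (w \<bullet> z)" for z w :: complex
      using m(1)[of 2 z w] m(2)[of w 2 z] by simp_all
    consider "j \<le> -2" | "j = -1" | "j = 0" | "j = 1" | "j \<ge> 2" by linarith
    then show ?thesis
    proof cases
      case 1
      then show ?thesis
        by (simp add: W_def V_def A_seq_def m two inner_add inner_diff ring_distribs
            del: of_real_divide of_real_add)
    next
      case 2
      then show ?thesis
        by (simp add: W_def V_def A_seq_def m two inner_add inner_diff ring_distribs
            del: of_real_divide of_real_add)
    next
      case 3
      then show ?thesis by (simp add: W_def F0)
    next
      case 4
      then show ?thesis
        by (simp add: W_def V_def A_seq_def m two inner_add inner_diff ring_distribs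
            del: of_real_divide of_real_add)
    next
      case 5
      then show ?thesis
        by (simp add: W_def V_def A_seq_def m two inner_add inner_diff ring_distribs
            del: of_real_divide of_real_add)
    qed
  qed
  have "blinfun_apply (A_op b1 b2) f \<bullet> g - f \<bullet> blinfun_apply (A_op b1 b2) g
      = (\<Sum>\<^sub>\<infinity>j. A_seq b1 b2 F j \<bullet> G j - F j \<bullet> A_seq b1 b2 G j)"
    unfolding inner_ell2_def coord_A_op F_def G_def
    by (intro summable_on_diff_real(2)[symmetric] sq_summable_inner sq_summable_A_seq sq_summable_coord)
  also have "\<dots> = (\<Sum>\<^sub>\<infinity>j. W j) - (\<Sum>\<^sub>\<infinity>j. W (j - 1))"
    unfolding eq by (intro summable_on_diff_real(2) W W')
  also have "\<dots> = 0"
    using infsum_reindex_bij_betw[OF bij, of W] by simp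
  finally show ?thesis by simp
qed


section \<open>Boundary values of the resolvent\<close>

definition I_set :: "real \<Rightarrow> real \<Rightarrow> real set" where
  "I_set b1 b2 = {- 4 * max (1 / b1\<^sup>2) (1 / b2\<^sup>2) .. 0}"

definition root_in_disc :: "real \<Rightarrow> complex \<Rightarrow> complex" where
  "root_in_disc b z = (THE r. cmod r < 1 \<and> r\<^sup>2 - 2 * r + 1 = z * of_real (b\<^sup>2) * r)"

text \<open>In the following, \<open>\<sigma>\<close> is \<open>1\<close> or \<open>-1\<close>, for the limit from above or below.\<close>

definition r_lim :: "real \<Rightarrow> real \<Rightarrow> real \<Rightarrow> complex" where
  "r_lim \<sigma> b \<omega> = Lim (at_right 0) (\<lambda>\<epsilon>. root_in_disc b (Complex \<omega> (\<sigma> * \<epsilon>)))"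

text \<open>
  Whenever a denominator vanishes, the value of this expression is meaningless;
  for \<open>\<omega>\<close> in the interval above this happens for at most three \<open>\<omega>\<close>.
\<close>

definition R_op ::
  "real \<Rightarrow> real \<Rightarrow> real \<Rightarrow> real \<Rightarrow> (int \<Rightarrow> complex) \<Rightarrow> int \<Rightarrow> complex" where
  "R_op \<sigma> b1 b2 \<omega> \<phi> j =
    (let r1 = r_lim \<sigma> b1 \<omega>; r2 = r_lim \<sigma> b2 \<omega>;
         b = (if j < 0 then b1 else b2);
         r = (if j < 0 then r1 else r2);
         Z = (if j < 0 then {..-1} else {1..})
     in - (r ^ nat \<bar>j\<bar>)
          / (of_real (1 / b2\<^sup>2) * (1 - r2) + of_real (1 / b1\<^sup>2) * (1 - r1))
          * ((\<Sum>\<^sub>\<infinity>k\<in>{..-1}. r1 ^ nat \<bar>k\<bar> * \<phi> k) + (\<Sum>\<^sub>\<infinity>k\<in>{1..}. r2 ^ nat \<bar>k\<bar> * \<phi> k))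
        + of_real (b\<^sup>2) / (r - 1 / r)
          * (\<Sum>\<^sub>\<infinity>k\<in>Z. (r ^ nat \<bar>j - k\<bar> - r ^ (nat \<bar>j\<bar> + nat \<bar>k\<bar>)) * \<phi> k))"

end

theory Submission
  imports Defs "HOL-Complex_Analysis.Cauchy_Integral_Theorem" "HOL-Real_Asymp.Real_Asymp"
begin

text \<open>
This is Stone's formula for the operator \<open>A\<close>: the boundary values \<open>R\<^sup>\<plusminus>(\<omega>)\<close> are the limits of the
resolvent \<open>(A - z)\<^sup>-\<^sup>1\<close> at \<open>z = \<omega> \<plusminus> i0\<close>, and \<open>(R\<^sup>+(\<omega>) - R\<^sup>-(\<omega>)) / 2\<pi>i\<close> is the spectral density.
Since all kernels are explicit, the formula can be reduced to two elementary properties of the density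
\<open>W(\<omega>) = (R\<^sup>+(\<omega>) - R\<^sup>-(\<omega>))\<phi>\<close>.

Eigenfunctions. Both kernels \<open>R\<^sup>\<plusminus>(\<omega>)(\<cdot>, k)\<close> solve \<open>(A - \<omega>) G = \<delta>\<^sub>k\<close> (lemma \<open>A_seq_green\<close>), so
\<open>A W(\<omega>) = \<omega> W(\<omega>)\<close>. The equation at the two vertices next to the junction becomes the ordinary
second difference equation once a value at the missing vertex \<open>0\<close> is restored
(\<open>A_seq_interface\<close>); that value is the common factor in the first summand of \<open>R\<^sup>\<plusminus>\<close>.

Completeness. \<open>\<integral>\<^sub>I W(\<omega>)(n) d\<omega> = 2\<pi>i \<phi>(n)\<close>. For a single source \<open>k\<close> the integrand is a multiple of the
imaginary part of the kernel \<open>G\<^sub>z(n,k)\<close> at the real line (\<open>integral_Im_resolvent\<close>). This kernel is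
holomorphic for \<open>Im z < 0\<close>, real on the real line outside \<open>I\<close>, and \<open>-\<delta>\<^sub>n\<^sub>k/z + O(|z|\<^sup>-\<^sup>2)\<close> at infinity. After
adding \<open>\<delta>\<^sub>n\<^sub>k/(z - i)\<close> its integral over \<open>[-L, L]\<close> is \<open>O(1/L)\<close> by Cauchy's theorem, while the added term
has imaginary part \<open>\<delta>\<^sub>n\<^sub>k/(1 + x\<^sup>2)\<close> on the real line, with integral \<open>\<pi>\<delta>\<^sub>n\<^sub>k\<close>.

These give the moments \<open>\<integral>\<^sub>I \<omega>\<^sup>m W(\<omega>) d\<omega> = 2\<pi>i A\<^sup>m\<phi>\<close> by induction on \<open>m\<close>, and the theorem follows by
expanding \<open>e\<^sup>i\<^sup>t\<^sup>\<omega>\<close> into its power series, since \<open>I\<close> is bounded.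

The limit \<open>z \<rightarrow> \<omega> - i0\<close> and the sum over \<open>k\<close> are both exchanged with the integral by dominated
convergence, so everything needs an integrable bound of the kernel that is uniform in \<open>k\<close>. The
root in the disc is \<open>r = (s - 1)/(s + 1)\<close> with \<open>s\<^sup>2 = 1 + 4/(z b\<^sup>2)\<close>, and for \<open>Im z \<le> 0\<close> the principal
root \<open>s\<close> lies in the closed first quadrant. Hence \<open>1 - r = 2/(s + 1)\<close> lies in the fourth one, the two terms
of the denominator \<open>b\<^sub>2\<^sup>-\<^sup>2(1 - r\<^sub>2) + b\<^sub>1\<^sup>-\<^sup>2(1 - r\<^sub>1)\<close> cannot cancel, and the kernel is \<open>O(1 + |z|\<^sup>-\<^sup>1\<^sup>/\<^sup>2)\<close>.
\<close>

section \<open>The root in the unit disc and its boundary values\<close>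

definition disc_sqrt :: "real \<Rightarrow> complex \<Rightarrow> complex" where
  "disc_sqrt b z = csqrt (1 + 4 / (z * of_real (b\<^sup>2)))"

text \<open>
Solving \<open>(1 - r)\<^sup>2 = z b\<^sup>2 r\<close> through the Cayley transform turns the choice of the root inside the disc into
the choice of the square root with nonnegative real part. The formula is single valued also for
real \<open>z\<close>, where it gives the boundary value from below.
\<close>

definition disc_root :: "real \<Rightarrow> complex \<Rightarrow> complex" where
  "disc_root b z = (disc_sqrt b z - 1) / (disc_sqrt b z + 1)"

lemma Re_disc_sqrt_ge_0: "0 \<le> Re (disc_sqrt b z)"
  using csqrt_principal[of "1 + 4 / (z * of_real (b\<^sup>2))"] by (auto simp: disc_sqrt_def)

lemma disc_sqrt_plus_1_nonzero [simp]: "disc_sqrt b z + 1 \<noteq> 0"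
proof
  assume "disc_sqrt b z + 1 = 0"
  then have "disc_sqrt b z = -1" by (simp add: add_eq_0_iff2)
  with Re_disc_sqrt_ge_0[of b z] show False by simp
qed

lemma one_minus_disc_root: "1 - disc_root b z = 2 / (disc_sqrt b z + 1)"
proof -
  have "1 - disc_root b z = (disc_sqrt b z + 1) / (disc_sqrt b z + 1)
      - (disc_sqrt b z - 1) / (disc_sqrt b z + 1)"
    by (simp add: disc_root_def)
  also have "\<dots> = ((disc_sqrt b z + 1) - (disc_sqrt b z - 1)) / (disc_sqrt b z + 1)"
    by (rule diff_divide_distrib[symmetric])
  finally show ?thesis by simp
qed

lemma disc_sqrt_squared:
  assumes "b \<noteq> 0" "z \<noteq> 0"
  shows "z * of_real (b\<^sup>2) * ((disc_sqrt b z)\<^sup>2 - 1) = 4"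
  using assms by (simp add: disc_sqrt_def)

lemma disc_root_equation:
  assumes "b \<noteq> 0" "z \<noteq> 0"
  shows "(disc_root b z)\<^sup>2 - 2 * disc_root b z + 1 = z * of_real (b\<^sup>2) * disc_root b z"
proof -
  define s where "s = disc_sqrt b z"
  have s: "s + 1 \<noteq> 0" and eq: "z * of_real (b\<^sup>2) * (s\<^sup>2 - 1) = 4"
    using disc_sqrt_squared[OF assms] by (simp_all add: s_def)
  have "(disc_root b z)\<^sup>2 - 2 * disc_root b z + 1 = (1 - disc_root b z)\<^sup>2"
    by (simp add: power2_eq_square algebra_simps)
  also have "\<dots> = 4 / (s + 1)\<^sup>2"
    by (simp add: one_minus_disc_root s_def power_divide)
  also have "\<dots> = z * of_real (b\<^sup>2) * ((s\<^sup>2 - 1) / (s + 1)\<^sup>2)"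
    using eq by (metis times_divide_eq_right)
  also have "(s\<^sup>2 - 1) / (s + 1)\<^sup>2 = disc_root b z"
  proof -
    have "s\<^sup>2 - 1 = (s - 1) * (s + 1)" by (simp add: power2_eq_square algebra_simps)
    moreover have "(s + 1)\<^sup>2 = (s + 1) * (s + 1)" by (simp add: power2_eq_square)
    ultimately show ?thesis
      unfolding disc_root_def s_def[symmetric]
      by (simp only: nonzero_mult_divide_mult_cancel_right[OF s])
  qed
  finally show ?thesis .
qed

lemma disc_root_nonzero:
  assumes "b \<noteq> 0" "z \<noteq> 0"
  shows "disc_root b z \<noteq> 0"
proof
  assume "disc_root b z = 0"
  with disc_root_equation[OF assms] show False by simp
qed

lemma cmod_disc_root_le_1: "cmod (disc_root b z) \<le> 1"
proof -
  have "cmod (disc_sqrt b z - 1) \<le> cmod (disc_sqrt b z + 1)"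
    using Re_disc_sqrt_ge_0[of b z]
    by (simp add: cmod_def power2_eq_square algebra_simps)
  then show ?thesis by (simp add: disc_root_def norm_divide divide_le_eq_1)
qed

lemma Im_disc_sqrt_arg:
  "Im (1 + 4 / (z * of_real (b\<^sup>2))) = - 4 * Im z / ((cmod z)\<^sup>2 * b\<^sup>2)"
proof -
  have "1 + 4 / (z * of_real (b\<^sup>2)) = 1 + of_real (4 / b\<^sup>2) * (1 / z)"
    by simp
  then show ?thesis
    by (simp add: Im_divide cmod_power2 del: of_real_divide)
qed

lemma Re_disc_sqrt_pos:
  assumes "b \<noteq> 0" "Im z \<noteq> 0"
  shows "0 < Re (disc_sqrt b z)"
proof (rule ccontr)
  assume "\<not> ?thesis"
  then have "Re (disc_sqrt b z) = 0" using Re_disc_sqrt_ge_0[of b z] by simp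
  then have "Im ((disc_sqrt b z)\<^sup>2) = 0" by (simp add: power2_eq_square)
  then have "Im (1 + 4 / (z * of_real (b\<^sup>2))) = 0" by (simp only: disc_sqrt_def power2_csqrt)
  then show False using assms unfolding Im_disc_sqrt_arg by auto
qed

lemma cmod_disc_root_less_1:
  assumes "b \<noteq> 0" "Im z \<noteq> 0"
  shows "cmod (disc_root b z) < 1"
proof -
  have "cmod (disc_sqrt b z - 1) < cmod (disc_sqrt b z + 1)"
    using Re_disc_sqrt_pos[OF assms]
    by (simp add: cmod_def power2_eq_square algebra_simps)
  then show ?thesis by (simp add: disc_root_def norm_divide divide_less_eq_1)
qed

text \<open>
Two different roots have product \<open>1\<close>, so at most one lies in the open disc.
\<close>

lemma root_in_disc_eqI:
  assumes "cmod r < 1" "r\<^sup>2 - 2 * r + 1 = z * of_real (b\<^sup>2) * r"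
  shows "root_in_disc b z = r"
  unfolding root_in_disc_def
proof (rule the_equality)
  fix r' assume r': "cmod r' < 1 \<and> r'\<^sup>2 - 2 * r' + 1 = z * of_real (b\<^sup>2) * r'"
  define w where "w = z * of_real (b\<^sup>2)"
  have e: "r\<^sup>2 - 2 * r + 1 = w * r" "r'\<^sup>2 - 2 * r' + 1 = w * r'"
    using assms r' by (simp_all add: w_def)
  have "(r * r' - 1) * (r - r')
      = r' * (r\<^sup>2 - 2 * r + 1 - w * r) - r * (r'\<^sup>2 - 2 * r' + 1 - w * r')"
    by (simp add: power2_eq_square algebra_simps)
  then have "(r * r' - 1) * (r - r') = 0" by (simp add: e)
  moreover have "r * r' \<noteq> 1"
  proof
    assume "r * r' = 1"
    then have "cmod r * cmod r' = 1" by (metis norm_mult norm_one)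
    moreover have "cmod r * cmod r' < 1 * 1"
      using assms r' by (intro mult_strict_mono') auto
    ultimately show False by simp
  qed
  ultimately show "r' = r" by simp
qed (use assms in auto)

lemma root_in_disc_eq_disc_root:
  assumes "b \<noteq> 0" "Im z \<noteq> 0"
  shows "root_in_disc b z = disc_root b z"
proof (rule root_in_disc_eqI)
  have "z \<noteq> 0" using assms by auto
  then show "(disc_root b z)\<^sup>2 - 2 * disc_root b z + 1 = z * of_real (b\<^sup>2) * disc_root b z"
    by (rule disc_root_equation[OF assms(1)])
qed (rule cmod_disc_root_less_1[OF assms])

lemma root_in_disc_cnj:
  assumes "b \<noteq> 0" "Im z \<noteq> 0"
  shows "root_in_disc b (cnj z) = cnj (root_in_disc b z)"
proof -
  have "z \<noteq> 0" using assms by auto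
  from arg_cong[OF disc_root_equation[OF assms(1) this], of cnj]
  have "root_in_disc b (cnj z) = cnj (disc_root b z)"
    by (intro root_in_disc_eqI) (use assms in \<open>simp_all add: cmod_disc_root_less_1\<close>)
  then show ?thesis using assms by (simp add: root_in_disc_eq_disc_root)
qed

text \<open>
On the cut the principal square root takes its limit from above. This is why the lower half
plane is the convenient one for \<open>z\<close>: the map \<open>z \<mapsto> 1 + 4/(z b\<^sup>2)\<close> sends it to the upper half plane.
\<close>

lemma continuous_on_csqrt_upper: "continuous_on {z. 0 \<le> Im z} csqrt"
proof -
  have "continuous_on {z. 0 \<le> Im z}
          (\<lambda>z. Complex (sqrt ((cmod z + Re z) / 2)) (sqrt ((cmod z - Re z) / 2)))"
    by (intro continuous_intros) auto
  also have "?this \<longleftrightarrow> ?thesis"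
  proof (intro continuous_on_cong refl)
    fix z assume "z \<in> {z. 0 \<le> Im z}"
    then show "Complex (sqrt ((cmod z + Re z) / 2)) (sqrt ((cmod z - Re z) / 2)) = csqrt z"
      by (cases "Im z = 0") (simp_all add: complex_eq_iff sgn_if)
  qed
  finally show ?thesis .
qed

lemma Im_disc_sqrt_arg_nonneg:
  assumes "Im z \<le> 0" shows "0 \<le> Im (1 + 4 / (z * of_real (b\<^sup>2)))"
  unfolding Im_disc_sqrt_arg using assms by (simp add: divide_nonpos_nonneg)

lemma Im_disc_sqrt_ge_0:
  assumes "Im z \<le> 0" shows "0 \<le> Im (disc_sqrt b z)"
  using Im_disc_sqrt_arg_nonneg[OF assms, of b]
    complex_Re_le_cmod[of "1 + 4 / (z * of_real (b\<^sup>2))"]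
  unfolding disc_sqrt_def by (auto simp add: sgn_if simp del: Im_divide plus_complex.sel)

lemma continuous_on_disc_sqrt:
  assumes "b \<noteq> 0"
  shows "continuous_on {z. Im z \<le> 0 \<and> z \<noteq> 0} (disc_sqrt b)"
  unfolding disc_sqrt_def[abs_def]
  by (rule continuous_on_compose2[OF continuous_on_csqrt_upper])
     (use assms in \<open>auto intro!: continuous_intros Im_disc_sqrt_arg_nonneg
        simp del: plus_complex.sel of_real_power\<close>)

lemma continuous_on_disc_root:
  assumes "b \<noteq> 0"
  shows "continuous_on {z. Im z \<le> 0 \<and> z \<noteq> 0} (disc_root b)"
  unfolding disc_root_def[abs_def]
  using continuous_on_disc_sqrt[OF assms] by (intro continuous_intros) auto

lemma holomorphic_on_disc_sqrt:
  assumes "b \<noteq> 0"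
  shows "disc_sqrt b holomorphic_on {z. Im z < 0}"
proof -
  have "1 + 4 / (z * of_real (b\<^sup>2)) \<notin> \<real>\<^sub>\<le>\<^sub>0" if "Im z < 0" for z
  proof -
    have "Im (1 + 4 / (z * of_real (b\<^sup>2))) \<noteq> 0"
      unfolding Im_disc_sqrt_arg using that assms by auto
    then show ?thesis by (auto simp: complex_nonpos_Reals_iff)
  qed
  then show ?thesis
    unfolding disc_sqrt_def[abs_def] using assms by (intro holomorphic_intros) auto
qed

lemma holomorphic_on_disc_root:
  assumes "b \<noteq> 0"
  shows "disc_root b holomorphic_on {z. Im z < 0}"
  unfolding disc_root_def[abs_def]
  using holomorphic_on_disc_sqrt[OF assms] by (intro holomorphic_intros) auto

text \<open>
The origin is left out here and below because the kernels are singular at the edge \<open>0\<close> of the spectrum.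
\<close>

lemma tendsto_lower_boundary:
  assumes "continuous_on {z. Im z \<le> 0 \<and> z \<noteq> 0} f" "x \<noteq> 0"
  shows "((\<lambda>\<epsilon>. f (Complex x (- \<epsilon>))) \<longlongrightarrow> f (of_real x)) (at_right 0)"
proof (rule continuous_on_tendsto_compose[OF assms(1)])
  have "((\<lambda>\<epsilon>. Complex x (- \<epsilon>)) \<longlongrightarrow> Complex x (- 0)) (at_right 0)"
    by (intro tendsto_intros)
  then show "((\<lambda>\<epsilon>. Complex x (- \<epsilon>)) \<longlongrightarrow> of_real x) (at_right 0)"
    by (simp add: complex_of_real_def)
  show "\<forall>\<^sub>F \<epsilon> in at_right 0. Complex x (- \<epsilon>) \<in> {z. Im z \<le> 0 \<and> z \<noteq> 0}"
    using eventually_at_right_less[of 0]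
    by eventually_elim (use assms(2) in \<open>auto simp: complex_eq_iff\<close>)
qed (use assms(2) in auto)

text \<open>
The limit from the upper half plane is obtained by conjugating the one from the lower half plane.
\<close>

lemma r_lim_eq_disc_root:
  assumes "b \<noteq> 0" "\<omega> \<noteq> 0"
  shows "r_lim (-1) b \<omega> = disc_root b (of_real \<omega>)"
    and "r_lim 1 b \<omega> = cnj (disc_root b (of_real \<omega>))"
proof -
  have lim: "((\<lambda>\<epsilon>. disc_root b (Complex \<omega> (- \<epsilon>))) \<longlongrightarrow> disc_root b (of_real \<omega>)) (at_right 0)"
    by (rule tendsto_lower_boundary[OF continuous_on_disc_root[OF assms(1)] assms(2)])
  have "((\<lambda>\<epsilon>. root_in_disc b (Complex \<omega> (-1 * \<epsilon>))) \<longlongrightarrow> disc_root b (of_real \<omega>)) (at_right 0)"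
    by (rule Lim_transform_eventually[OF lim])
       (use eventually_at_right_less[of 0] in eventually_elim,
        use assms in \<open>simp add: root_in_disc_eq_disc_root\<close>)
  then show "r_lim (-1) b \<omega> = disc_root b (of_real \<omega>)"
    unfolding r_lim_def by (intro tendsto_Lim) auto
  have "root_in_disc b (Complex \<omega> \<epsilon>) = cnj (disc_root b (Complex \<omega> (- \<epsilon>)))" if "\<epsilon> > 0" for \<epsilon>
    using root_in_disc_cnj[of b "Complex \<omega> (- \<epsilon>)"] that assms
    by (simp add: root_in_disc_eq_disc_root complex_cnj)
  then have "((\<lambda>\<epsilon>. root_in_disc b (Complex \<omega> (1 * \<epsilon>))) \<longlongrightarrow> cnj (disc_root b (of_real \<omega>))) (at_right 0)"
    by (intro Lim_transform_eventually[OF tendsto_cnj[OF lim]])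
       (use eventually_at_right_less[of 0] in eventually_elim, simp)
  then show "r_lim 1 b \<omega> = cnj (disc_root b (of_real \<omega>))"
    unfolding r_lim_def by (intro tendsto_Lim) auto
qed

lemma disc_root_real:
  assumes "x \<notin> {- 4 / b\<^sup>2 .. 0}" "b \<noteq> 0"
  shows "disc_root b (of_real x) \<in> \<real>"
proof -
  have "0 \<le> 1 + 4 / (x * b\<^sup>2)"
  proof (cases "x > 0")
    case False
    then have "x * b\<^sup>2 < -4" using assms by (auto simp: field_simps)
    then have "-1 \<le> 4 / (x * b\<^sup>2)" by (subst neg_le_divide_eq) linarith+
    then show ?thesis by simp
  qed auto
  note nonneg = this
  have "1 + 4 / (of_real x * of_real (b\<^sup>2)) = complex_of_real (1 + 4 / (x * b\<^sup>2))" by simp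
  then have "disc_sqrt b (of_real x) = of_real (sqrt (1 + 4 / (x * b\<^sup>2)))"
    unfolding disc_sqrt_def by (simp only: of_real_sqrt[OF nonneg])
  then show ?thesis unfolding disc_root_def
    by (metis Reals_1 Reals_add Reals_diff Reals_divide Reals_of_real)
qed

section \<open>Green's kernel of the two half lines\<close>

text \<open>
The junction \<open>0\<close>, which is not a vertex of the graph, is assigned to the right half line; the expressions for the
kernels below on the two sides agree at \<open>0\<close>.
\<close>

definition side :: "int \<Rightarrow> 'a \<Rightarrow> 'a \<Rightarrow> 'a" where
  "side n x y = (if n < 0 then x else y)"

lemma side_simps [simp]: "n < 0 \<Longrightarrow> side n x y = x" "0 \<le> n \<Longrightarrow> side n x y = y"
  by (simp_all add: side_def)

definition vertex_denom :: "real \<Rightarrow> real \<Rightarrow> complex \<Rightarrow> complex \<Rightarrow> complex" where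
  "vertex_denom b1 b2 r1 r2 = of_real (1 / b2\<^sup>2) * (1 - r2) + of_real (1 / b1\<^sup>2) * (1 - r1)"

text \<open>
The resolvent kernel of the half line with a zero boundary value at \<open>0\<close>, up to sign. Writing
\<open>(r\<^sup>|\<^sup>n\<^sup>-\<^sup>k\<^sup>| - r\<^sup>|\<^sup>n\<^sup>|\<^sup>+\<^sup>|\<^sup>k\<^sup>|) / (r - r\<^sup>-\<^sup>1)\<close> as a geometric sum keeps it holomorphic and bounded near \<open>r\<^sup>2 = 1\<close>, that is, at the
edges of the spectrum.
\<close>

definition dirichlet_kernel :: "real \<Rightarrow> complex \<Rightarrow> int \<Rightarrow> int \<Rightarrow> complex" where
  "dirichlet_kernel b r n k =
    of_real (b\<^sup>2) * r ^ (nat \<bar>n - k\<bar> + 1) * (\<Sum>i<nat (min \<bar>n\<bar> \<bar>k\<bar>). r ^ (2 * i))"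

definition green ::
  "real \<Rightarrow> real \<Rightarrow> complex \<Rightarrow> complex \<Rightarrow> int \<Rightarrow> int \<Rightarrow> complex" where
  "green b1 b2 r1 r2 n k =
    - (side n r1 r2 ^ nat \<bar>n\<bar> * side k r1 r2 ^ nat \<bar>k\<bar> / vertex_denom b1 b2 r1 r2)
    - (if (n < 0) = (k < 0) then dirichlet_kernel (side k b1 b2) (side k r1 r2) n k else 0)"

lemma dirichlet_kernel_closed_form:
  assumes "r\<^sup>2 \<noteq> 1" "0 \<le> n * k"
  shows "dirichlet_kernel b r n k
    = of_real (b\<^sup>2) * r / (1 - r\<^sup>2) * (r ^ nat \<bar>n - k\<bar> - r ^ (nat \<bar>n\<bar> + nat \<bar>k\<bar>))"
proof -
  define d m where "d = nat \<bar>n - k\<bar>" and "m = nat (min \<bar>n\<bar> \<bar>k\<bar>)"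
  have "nat \<bar>n\<bar> + nat \<bar>k\<bar> = d + 2 * m"
    using assms(2) unfolding d_def m_def zero_le_mult_iff by auto
  moreover have "(\<Sum>i<m. r ^ (2 * i)) = (1 - r ^ (2 * m)) / (1 - r\<^sup>2)"
    using sum_gp_strict[of "r\<^sup>2" m] assms(1) by (simp add: power_mult)
  ultimately show ?thesis
    unfolding dirichlet_kernel_def d_def[symmetric] m_def[symmetric]
    by (simp add: power_add algebra_simps)
qed

lemma dirichlet_kernel_0 [simp]: "dirichlet_kernel b r 0 k = 0"
  by (simp add: dirichlet_kernel_def)

lemma dirichlet_kernel_uminus [simp]:
  "dirichlet_kernel b r (- n) (- k) = dirichlet_kernel b r n k"
  by (simp add: dirichlet_kernel_def abs_minus_commute[of n k])

lemma green_0: "k \<noteq> 0 \<Longrightarrow> green b1 b2 r1 r2 0 k = - (side k r1 r2 ^ nat \<bar>k\<bar> / vertex_denom b1 b2 r1 r2)"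
  by (simp add: green_def)

lemma green_reflect:
  assumes "k \<noteq> 0"
  shows "green b1 b2 r1 r2 n k = green b2 b1 r2 r1 (- n) (- k)"
  using assms
  by (cases "n = 0") (auto simp: green_def vertex_denom_def side_def add.commute)

text \<open>
Exchanging the two half lines is a symmetry, so that it suffices to verify the resolvent equation on the right one.
\<close>

lemma A_seq_reflect: "A_seq b1 b2 f n = A_seq b2 b1 (\<lambda>j. f (- j)) (- n)"
  by (auto simp: A_seq_def algebra_simps)

lemma second_difference_power:
  fixes r w :: complex
  assumes "r\<^sup>2 - 2 * r + 1 = w * r"
  shows "r ^ (m + 2) - 2 * r ^ (m + 1) + r ^ m = w * r ^ (m + 1)"
proof -
  have "r ^ (m + 2) - 2 * r ^ (m + 1) + r ^ m = (r\<^sup>2 - 2 * r + 1) * r ^ m"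
    by (simp add: power_add power2_eq_square algebra_simps)
  then show ?thesis by (simp add: assms)
qed

text \<open>
The kink of \<open>|a|\<close> at \<open>0\<close> produces the point source.
\<close>

lemma second_difference_power_abs:
  fixes r w :: complex and a :: int
  assumes "r\<^sup>2 - 2 * r + 1 = w * r" "r \<noteq> 0"
  shows "r ^ nat \<bar>a + 1\<bar> - 2 * r ^ nat \<bar>a\<bar> + r ^ nat \<bar>a - 1\<bar>
    = w * r ^ nat \<bar>a\<bar> + (if a = 0 then r - 1 / r else 0)"
proof -
  consider "a = 0" | m where "a = int m + 1" | m where "a = - (int m + 1)"
    by (metis add.commute linorder_cases minus_equation_iff neg_0_less_iff_less
        zless_iff_Suc_zadd of_nat_Suc add_0)
  then show ?thesis
  proof cases
    case 1
    have "(2 * r - 2) * r = (w + r - 1 / r) * r"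
      using assms by (simp add: algebra_simps power2_eq_square)
    then have "2 * r - 2 = w + r - 1 / r" using assms(2) by (simp only: mult_cancel_right) simp
    then show ?thesis using 1 by (simp add: algebra_simps)
  next
    case (2 m)
    have "nat \<bar>a + 1\<bar> = m + 2" "nat \<bar>a\<bar> = m + 1" "nat \<bar>a - 1\<bar> = m" "a \<noteq> 0" using 2 by auto
    then show ?thesis using second_difference_power[OF assms(1), of m] by simp
  next
    case (3 m)
    have "nat \<bar>a + 1\<bar> = m" "nat \<bar>a\<bar> = m + 1" "nat \<bar>a - 1\<bar> = m + 2" "a \<noteq> 0" using 3 by auto
    then show ?thesis using second_difference_power[OF assms(1), of m]
      by (simp add: algebra_simps)
  qed
qed

lemma second_difference_dirichlet_kernel:
  fixes r w :: complex
  assumes eq: "r\<^sup>2 - 2 * r + 1 = w * r" and nz: "r \<noteq> 0" "r\<^sup>2 \<noteq> 1" and pos: "0 < n" "0 < k"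
  shows "dirichlet_kernel b r (n + 1) k - 2 * dirichlet_kernel b r n k + dirichlet_kernel b r (n - 1) k
    = w * dirichlet_kernel b r n k - (if n = k then of_real (b\<^sup>2) else 0)"
proof -
  define c where "c = of_real (b\<^sup>2) * r / (1 - r\<^sup>2)"
  define E where "E = (\<lambda>j. r ^ nat \<bar>j - k\<bar>)"
  define P where "P = (\<lambda>j. r ^ nat \<bar>j\<bar>)"
  have dk: "dirichlet_kernel b r j k = c * (E j - P j * P k)" if "0 \<le> j" for j
    using dirichlet_kernel_closed_form[of r j k b] that pos nz
    by (simp add: c_def E_def P_def power_add)
  have E: "E (n + 1) - 2 * E n + E (n - 1) = w * E n + (if n = k then r - 1 / r else 0)"
    using second_difference_power_abs[OF eq nz(1), of "n - k"]
    by (simp add: E_def algebra_simps)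
  have P: "P (n + 1) - 2 * P n + P (n - 1) = w * P n"
    using second_difference_power_abs[OF eq nz(1), of n] pos by (simp add: P_def)
  have "1 - r\<^sup>2 \<noteq> 0" using nz by auto
  then have c: "c * (r - 1 / r) = - of_real (b\<^sup>2)"
    unfolding c_def using nz(1) by (simp add: field_simps power2_eq_square)
  have "dirichlet_kernel b r (n + 1) k - 2 * dirichlet_kernel b r n k + dirichlet_kernel b r (n - 1) k
      = c * (E (n + 1) - 2 * E n + E (n - 1)) - c * P k * (P (n + 1) - 2 * P n + P (n - 1))"
    using pos by (simp add: dk algebra_simps)
  also have "\<dots> = w * dirichlet_kernel b r n k + c * (if n = k then r - 1 / r else 0)"
    unfolding E P using pos by (simp add: dk algebra_simps)
  also have "c * (if n = k then r - 1 / r else 0) = - (if n = k then of_real (b\<^sup>2) else 0)"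
    using c by simp
  finally show ?thesis by simp
qed

text \<open>
The coefficient \<open>1/(b\<^sub>1\<^sup>2 + b\<^sub>2\<^sup>2)\<close> of \<open>A\<close> arises by eliminating a value at the junction \<open>0\<close> from Kirchhoff's
condition \<open>b\<^sub>1\<^sup>-\<^sup>2(f(-1) - f(0)) + b\<^sub>2\<^sup>-\<^sup>2(f(1) - f(0)) = 0\<close>. If \<open>f(0)\<close> satisfies this condition, \<open>A\<close> is the plain second
difference up to the vertex next to the junction.
\<close>

lemma A_seq_interface:
  assumes b: "0 < b1" "0 < b2"
    and interface: "of_real (1 / b1\<^sup>2) * (f (-1) - f 0) + of_real (1 / b2\<^sup>2) * (f 1 - f 0) = 0"
    and n: "0 < n"
  shows "A_seq b1 b2 f n = of_real (1 / b2\<^sup>2) * (f (n + 1) - 2 * f n + f (n - 1))"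
proof (cases "n = 1")
  case True
  define p q c :: complex where "p = of_real (1 / b1\<^sup>2)" and "q = of_real (1 / b2\<^sup>2)"
    and "c = of_real (1 / (b1\<^sup>2 + b2\<^sup>2))"
  have "0 < b1\<^sup>2 + b2\<^sup>2" using b by (intro add_pos_pos) auto
  then have "1 / (b1\<^sup>2 + b2\<^sup>2) * (1 / b1\<^sup>2 + 1 / b2\<^sup>2) = 1 / b1\<^sup>2 * (1 / b2\<^sup>2)"
    using b by (simp add: divide_simps)
  \<comment> \<open>The weight across the junction is that of the two edges of weights \<open>p\<close> and \<open>q\<close> in series.\<close>
  then have cpq: "c * (p + q) = p * q"
    unfolding p_def q_def c_def of_real_add[symmetric] of_real_mult[symmetric] by (simp only:)
  have "1 / b1\<^sup>2 + 1 / b2\<^sup>2 > 0" using b by (intro add_pos_pos) auto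
  then have pq: "p + q \<noteq> 0"
    unfolding p_def q_def of_real_add[symmetric] of_real_eq_0_iff by linarith
  define X Y where "X = f 1 - f 0" and "Y = f (-1) - f 0"
  have XY: "p * Y = - q * X" using interface
    unfolding p_def[symmetric] q_def[symmetric] X_def[symmetric] Y_def[symmetric]
    by (simp add: add_eq_0_iff2)
  have "(p + q) * (c * (Y - X)) = (p + q) * (- q * X)"
  proof -
    have "(p + q) * (c * (Y - X)) = (c * (p + q)) * (Y - X)" by (simp only: mult_ac)
    also have "\<dots> = q * (p * Y) - p * q * X" by (simp only: cpq) (simp add: algebra_simps)
    also have "\<dots> = (p + q) * (- q * X)" by (simp only: XY) (simp add: algebra_simps)
    finally show ?thesis .
  qed
  then have cX: "c * (Y - X) = - q * X" using pq by (simp only: mult_cancel_left) simp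
  have "A_seq b1 b2 f 1 = c * f (-1) - (c + q) * f 1 + q * f 2"
    by (simp add: A_seq_def c_def q_def)
  also have "\<dots> = c * (Y - X) + q * X + q * (f 2 - 2 * f 1 + f 0)"
    by (simp add: X_def Y_def algebra_simps)
  finally show ?thesis using True cX by (simp add: q_def)
next
  case False
  then show ?thesis using n by (simp add: A_seq_def)
qed

text \<open>
The value at \<open>0\<close> is \<open>-r\<^sub>k\<^sup>|\<^sup>k\<^sup>|/D\<close>, and the denominator \<open>D\<close> is exactly what balances the flux of the half line kernel
through the junction.
\<close>

lemma green_interface:
  assumes b: "0 < b1" "0 < b2" and D: "vertex_denom b1 b2 r1 r2 \<noteq> 0" and k: "k \<noteq> 0"
  defines "f \<equiv> \<lambda>n. green b1 b2 r1 r2 n k"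
  shows "of_real (1 / b1\<^sup>2) * (f (-1) - f 0) + of_real (1 / b2\<^sup>2) * (f 1 - f 0) = 0"
proof -
  define C where "C = side k r1 r2 ^ nat \<bar>k\<bar> / vertex_denom b1 b2 r1 r2"
  define p q :: complex where "p = of_real (1 / b1\<^sup>2)" and "q = of_real (1 / b2\<^sup>2)"
  have C: "C * (q * (1 - r2) + p * (1 - r1)) = side k r1 r2 ^ nat \<bar>k\<bar>"
    using D unfolding C_def vertex_denom_def p_def q_def by simp
  have f0: "f 0 = - C" using k by (simp add: f_def green_0 C_def)
  show ?thesis
  proof (cases "k < 0")
    case True
    then have e: "nat (min \<bar>- 1\<bar> \<bar>k\<bar>) = 1" "nat \<bar>- 1 - k\<bar> + 1 = nat \<bar>k\<bar>" by auto
    have "dirichlet_kernel b1 r1 (-1) k = of_real (b1\<^sup>2) * r1 ^ nat \<bar>k\<bar>"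
      unfolding dirichlet_kernel_def e by simp
    then have f_minus: "p * f (-1) = - p * r1 * C - r1 ^ nat \<bar>k\<bar>"
      using True b by (simp add: f_def green_def C_def p_def algebra_simps)
    have f_plus: "f 1 = - r2 * C" using True by (simp add: f_def green_def C_def)
    have "p * (f (-1) - f 0) + q * (f 1 - f 0) = p * f (-1) + p * C + q * (f 1 + C)"
      by (simp add: f0 algebra_simps)
    also have "\<dots> = C * (q * (1 - r2) + p * (1 - r1)) - r1 ^ nat \<bar>k\<bar>"
      by (simp only: f_minus f_plus) (simp add: algebra_simps)
    also have "\<dots> = 0" using True by (simp only: C) simp
    finally show ?thesis by (simp only: p_def q_def)
  next
    case False
    then have e: "nat (min \<bar>1\<bar> \<bar>k\<bar>) = 1" "nat \<bar>1 - k\<bar> + 1 = nat \<bar>k\<bar>" using k by auto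
    have "dirichlet_kernel b2 r2 1 k = of_real (b2\<^sup>2) * r2 ^ nat \<bar>k\<bar>"
      unfolding dirichlet_kernel_def e by simp
    then have f_plus: "q * f 1 = - q * r2 * C - r2 ^ nat \<bar>k\<bar>"
      using False b by (simp add: f_def green_def C_def q_def algebra_simps)
    have f_minus: "f (-1) = - r1 * C" using False by (simp add: f_def green_def C_def)
    have "p * (f (-1) - f 0) + q * (f 1 - f 0) = p * (f (-1) + C) + q * f 1 + q * C"
      by (simp add: f0 algebra_simps)
    also have "\<dots> = C * (q * (1 - r2) + p * (1 - r1)) - r2 ^ nat \<bar>k\<bar>"
      by (simp only: f_minus f_plus) (simp add: algebra_simps)
    also have "\<dots> = 0" using False by (simp only: C) simp
    finally show ?thesis by (simp only: p_def q_def)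
  qed
qed

lemma A_seq_green_pos:
  assumes b: "0 < b1" "0 < b2" and D: "vertex_denom b1 b2 r1 r2 \<noteq> 0"
    and eq: "r2\<^sup>2 - 2 * r2 + 1 = z * of_real (b2\<^sup>2) * r2" and r: "r2\<^sup>2 \<noteq> 1"
    and k: "k \<noteq> 0" and n: "0 < n"
  shows "A_seq b1 b2 (\<lambda>j. green b1 b2 r1 r2 j k) n
    = z * green b1 b2 r1 r2 n k + (if n = k then 1 else 0)"
proof -
  have r0: "r2 \<noteq> 0" using eq by auto
  define C where "C = side k r1 r2 ^ nat \<bar>k\<bar> / vertex_denom b1 b2 r1 r2"
  define H where "H = (\<lambda>j. if 0 < k then dirichlet_kernel b2 r2 j k else 0)"
  define w where "w = z * of_real (b2\<^sup>2)"
  define P where "P = (\<lambda>j. r2 ^ nat \<bar>j\<bar>)"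
  have g: "green b1 b2 r1 r2 j k = - P j * C - H j" if "0 \<le> j" for j
    using that k by (auto simp: green_def C_def H_def P_def)
  have P: "P (n + 1) - 2 * P n + P (n - 1) = w * P n"
    using second_difference_power_abs[OF eq r0, of n] n by (simp add: P_def w_def)
  have H: "H (n + 1) - 2 * H n + H (n - 1) = w * H n - (if n = k then of_real (b2\<^sup>2) else 0)"
    using second_difference_dirichlet_kernel[OF eq r0 r n, of k b2] n
    by (auto simp: H_def w_def)
  have "A_seq b1 b2 (\<lambda>j. green b1 b2 r1 r2 j k) n = of_real (1 / b2\<^sup>2)
      * (green b1 b2 r1 r2 (n + 1) k - 2 * green b1 b2 r1 r2 n k + green b1 b2 r1 r2 (n - 1) k)"
    by (rule A_seq_interface[OF b green_interface[OF b D k] n])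
  also have "\<dots> = of_real (1 / b2\<^sup>2) * (- C * (P (n + 1) - 2 * P n + P (n - 1))
      - (H (n + 1) - 2 * H n + H (n - 1)))"
    using n by (simp add: g algebra_simps)
  also have "\<dots> = of_real (1 / b2\<^sup>2) * (w * (- P n * C - H n) + (if n = k then of_real (b2\<^sup>2) else 0))"
    unfolding P H by (simp add: algebra_simps)
  also have "\<dots> = z * (- P n * C - H n) + (if n = k then 1 else 0)"
    using b by (simp add: w_def field_simps)
  finally show ?thesis using n by (simp add: g)
qed

lemma vertex_denom_commute: "vertex_denom b1 b2 r1 r2 = vertex_denom b2 b1 r2 r1"
  by (simp add: vertex_denom_def)

lemma A_seq_green:
  assumes b: "0 < b1" "0 < b2" and D: "vertex_denom b1 b2 r1 r2 \<noteq> 0"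
    and eq: "r1\<^sup>2 - 2 * r1 + 1 = z * of_real (b1\<^sup>2) * r1" "r2\<^sup>2 - 2 * r2 + 1 = z * of_real (b2\<^sup>2) * r2"
    and r: "r1\<^sup>2 \<noteq> 1" "r2\<^sup>2 \<noteq> 1"
    and k: "k \<noteq> 0" and n: "n \<noteq> 0"
  shows "A_seq b1 b2 (\<lambda>j. green b1 b2 r1 r2 j k) n
    = z * green b1 b2 r1 r2 n k + (if n = k then 1 else 0)"
proof (cases "0 < n")
  case True
  then show ?thesis by (intro A_seq_green_pos assms)
next
  case False
  then have "0 < - n" using n by simp
  have "A_seq b2 b1 (\<lambda>j. green b2 b1 r2 r1 j (- k)) (- n)
      = z * green b2 b1 r2 r1 (- n) (- k) + (if - n = - k then 1 else 0)"
    by (rule A_seq_green_pos) (use assms False vertex_denom_commute[of b1 b2] in auto)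
  then show ?thesis
    by (simp add: A_seq_reflect[of b1 b2 _ n] green_reflect[OF k])
qed

lemma green_cnj: "green b1 b2 (cnj r1) (cnj r2) n k = cnj (green b1 b2 r1 r2 n k)"
  by (auto simp: green_def dirichlet_kernel_def vertex_denom_def side_def)

section \<open>The resolvent kernel in the closed lower half plane\<close>

lemma cmod_le_cmod_add_quadrant:
  assumes "0 \<le> Re a" "Im a \<le> 0" "0 \<le> Re b" "Im b \<le> 0"
  shows "cmod a \<le> cmod (a + b)"
proof -
  have "(Re a)\<^sup>2 \<le> (Re (a + b))\<^sup>2" using assms by (intro power_mono) auto
  moreover have "(Im a)\<^sup>2 \<le> (Im (a + b))\<^sup>2"
    using assms by (simp add: abs_le_square_iff[symmetric])
  ultimately show ?thesis by (simp add: cmod_def del: plus_complex.sel)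
qed

lemma quadrant_one_minus_disc_root:
  assumes "Im z \<le> 0"
  shows "0 \<le> Re (1 - disc_root b z)" "Im (1 - disc_root b z) \<le> 0"
proof -
  define s where "s = disc_sqrt b z"
  have s: "0 \<le> Re s" "0 \<le> Im s"
    using Re_disc_sqrt_ge_0 Im_disc_sqrt_ge_0[OF assms] by (auto simp: s_def)
  have "0 \<le> Re (2 / (s + 1))" "Im (2 / (s + 1)) \<le> 0"
    using s by (auto simp: Re_divide Im_divide intro!: divide_nonneg_nonneg divide_nonpos_nonneg)
  then show "0 \<le> Re (1 - disc_root b z)" "Im (1 - disc_root b z) \<le> 0"
    unfolding one_minus_disc_root s_def by auto
qed

text \<open>
Near \<open>z = 0\<close> the square root has the order \<open>|z|\<^sup>-\<^sup>1\<^sup>/\<^sup>2\<close>, which is integrable along the real line.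
\<close>

lemma cmod_disc_sqrt_le:
  assumes "0 < b"
  shows "cmod (disc_sqrt b z) \<le> 1 + 2 / (b * sqrt (cmod z))"
proof -
  have "(cmod (disc_sqrt b z))\<^sup>2 = cmod (1 + 4 / (z * of_real (b\<^sup>2)))"
    unfolding disc_sqrt_def norm_power[symmetric] power2_csqrt ..
  also have "\<dots> \<le> 1 + 4 / (cmod z * b\<^sup>2)"
    by (rule order_trans[OF norm_triangle_ineq]) (simp add: norm_divide norm_mult norm_power)
  also have "\<dots> = 1\<^sup>2 + (2 / (b * sqrt (cmod z)))\<^sup>2"
    by (simp add: power_divide power_mult_distrib mult.commute)
  also have "\<dots> \<le> (1 + 2 / (b * sqrt (cmod z)))\<^sup>2"
    using assms by (simp add: power2_sum)
  finally show ?thesis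
    by (rule power2_le_imp_le) (use assms in auto)
qed

definition vertex_denom_at :: "real \<Rightarrow> real \<Rightarrow> complex \<Rightarrow> complex" where
  "vertex_denom_at b1 b2 z = vertex_denom b1 b2 (disc_root b1 z) (disc_root b2 z)"

text \<open>
Both terms of the denominator lie in the closed fourth quadrant, so they do not cancel and one of them
already bounds the sum from below.
\<close>

lemma vertex_denom_at_lower_bound:
  assumes b: "0 < b1" and z: "Im z \<le> 0"
  shows "2 / (b1\<^sup>2 * cmod (disc_sqrt b1 z + 1)) \<le> cmod (vertex_denom_at b1 b2 z)"
proof -
  define q1 q2 where "q1 = of_real (1 / b1\<^sup>2) * (1 - disc_root b1 z)"
    and "q2 = of_real (1 / b2\<^sup>2) * (1 - disc_root b2 z)"
  have scale: "0 \<le> Re (of_real c * w)" "Im (of_real c * w) \<le> 0"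
    if "0 \<le> c" "0 \<le> Re w" "Im w \<le> 0" for c w
    using that by (auto intro: mult_nonneg_nonpos)
  have "2 / (b1\<^sup>2 * cmod (disc_sqrt b1 z + 1)) = cmod q1"
    unfolding q1_def one_minus_disc_root by (simp add: norm_mult norm_divide norm_power)
  also have "\<dots> \<le> cmod (q1 + q2)"
    unfolding q1_def q2_def
    by (intro cmod_le_cmod_add_quadrant scale quadrant_one_minus_disc_root z) auto
  also have "q1 + q2 = vertex_denom_at b1 b2 z"
    by (simp add: vertex_denom_at_def vertex_denom_def q1_def q2_def)
  finally show ?thesis .
qed

lemma vertex_denom_at_nonzero:
  assumes "0 < b1" "Im z \<le> 0"
  shows "vertex_denom_at b1 b2 z \<noteq> 0"
proof -
  have "0 < 2 / (b1\<^sup>2 * cmod (disc_sqrt b1 z + 1))" using assms(1) by auto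
  with vertex_denom_at_lower_bound[OF assms, of b2] show ?thesis by auto
qed

lemma inverse_vertex_denom_at_bound:
  assumes b: "0 < b1" and z: "Im z \<le> 0"
  shows "1 / cmod (vertex_denom_at b1 b2 z) \<le> b1\<^sup>2 + b1 / sqrt (cmod z)"
proof -
  define N where "N = cmod (disc_sqrt b1 z + 1)"
  have N: "N > 0" unfolding N_def by simp
  have "1 / cmod (vertex_denom_at b1 b2 z) \<le> 1 / (2 / (b1\<^sup>2 * N))"
    using vertex_denom_at_lower_bound[OF assms, of b2] N b unfolding N_def[symmetric]
    by (intro divide_left_mono mult_pos_pos) (auto simp: vertex_denom_at_nonzero[OF assms])
  also have "\<dots> = b1\<^sup>2 * N / 2" by simp
  also have "N \<le> 2 + 2 / (b1 * sqrt (cmod z))"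
    using cmod_disc_sqrt_le[OF b, of z] norm_triangle_ineq[of "disc_sqrt b1 z" 1]
    unfolding N_def by simp
  then have "b1\<^sup>2 * N / 2 \<le> b1\<^sup>2 * (2 + 2 / (b1 * sqrt (cmod z))) / 2"
    by (intro divide_right_mono mult_left_mono) auto
  also have "\<dots> = b1\<^sup>2 + b1 / sqrt (cmod z)"
    using b by (simp add: algebra_simps power2_eq_square)
  finally show ?thesis .
qed

text \<open>
For \<open>Im z < 0\<close> this is the kernel of \<open>(A - z)\<^sup>-\<^sup>1\<close>, and for real \<open>z\<close> its limit from below. At \<open>z = 0\<close>, where the kernel
may be unbounded, the value is an artefact of division by zero.
\<close>

definition resolvent :: "real \<Rightarrow> real \<Rightarrow> complex \<Rightarrow> int \<Rightarrow> int \<Rightarrow> complex" where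
  "resolvent b1 b2 z n k = green b1 b2 (disc_root b1 z) (disc_root b2 z) n k"

lemma side_disc_root: "side n (disc_root b1 z) (disc_root b2 z) = disc_root (side n b1 b2) z"
  by (simp add: side_def)

lemma cmod_dirichlet_kernel_le:
  assumes "cmod r \<le> 1"
  shows "cmod (dirichlet_kernel b r n k) \<le> b\<^sup>2 * cmod r ^ (nat \<bar>n - k\<bar> + 1) * \<bar>of_int n\<bar>"
proof -
  have "cmod (\<Sum>i<nat (min \<bar>n\<bar> \<bar>k\<bar>). r ^ (2 * i)) \<le> (\<Sum>i<nat (min \<bar>n\<bar> \<bar>k\<bar>). 1)"
    using assms by (intro sum_norm_le) (simp add: norm_power power_le_one)
  also have "\<dots> \<le> \<bar>of_int n\<bar>" by simp
  finally show ?thesis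
    unfolding dirichlet_kernel_def norm_mult norm_power norm_of_real
    by (auto intro!: mult_left_mono)
qed

text \<open>
The bound does not depend on the source \<open>k\<close>: the half line kernel has at most \<open>|n|\<close> terms. This uniformity is what
allows the sum over \<open>k\<close> for an absolutely summable \<open>\<phi>\<close>.
\<close>

lemma cmod_resolvent_le:
  assumes b: "0 < b1" and z: "Im z \<le> 0"
  shows "cmod (resolvent b1 b2 z n k)
    \<le> b1\<^sup>2 + b1 / sqrt (cmod z) + (b1\<^sup>2 + b2\<^sup>2) * \<bar>of_int n\<bar>"
proof -
  define D where "D = vertex_denom_at b1 b2 z"
  define r where "r = (\<lambda>j. disc_root (side j b1 b2) z)"
  have r: "cmod (r j) \<le> 1" for j by (simp add: r_def cmod_disc_root_le_1)
  define H where "H = (if (n < 0) = (k < 0) then dirichlet_kernel (side k b1 b2) (r k) n k else 0)"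
  have res: "resolvent b1 b2 z n k = - (r n ^ nat \<bar>n\<bar> * r k ^ nat \<bar>k\<bar> / D) - H"
    unfolding resolvent_def green_def side_disc_root r_def H_def D_def vertex_denom_at_def ..
  have "cmod (r n ^ nat \<bar>n\<bar> * r k ^ nat \<bar>k\<bar> / D) = cmod (r n) ^ nat \<bar>n\<bar> * cmod (r k) ^ nat \<bar>k\<bar> * (1 / cmod D)"
    by (simp add: norm_mult norm_divide norm_power)
  also have "\<dots> \<le> 1 * 1 * (b1\<^sup>2 + b1 / sqrt (cmod z))"
    using inverse_vertex_denom_at_bound[OF assms] r
    by (intro mult_mono power_le_one) (auto simp: D_def)
  finally have 1: "cmod (r n ^ nat \<bar>n\<bar> * r k ^ nat \<bar>k\<bar> / D) \<le> b1\<^sup>2 + b1 / sqrt (cmod z)" by simp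
  have "cmod (dirichlet_kernel (side k b1 b2) (r k) n k) \<le> (b1\<^sup>2 + b2\<^sup>2) * 1 * \<bar>of_int n\<bar>"
    by (rule order_trans[OF cmod_dirichlet_kernel_le[OF r]])
       (intro mult_mono power_le_one r; simp add: side_def)
  then have 2: "cmod H \<le> (b1\<^sup>2 + b2\<^sup>2) * \<bar>of_int n\<bar>" by (auto simp: H_def)
  show ?thesis unfolding res
    using norm_triangle_ineq4[of "- (r n ^ nat \<bar>n\<bar> * r k ^ nat \<bar>k\<bar> / D)" H] 1 2 by simp
qed

lemma holomorphic_on_resolvent:
  assumes "0 < b1" "0 < b2"
  shows "(\<lambda>z. resolvent b1 b2 z n k) holomorphic_on {z. Im z < 0}"
proof -
  have [holomorphic_intros]: "(\<lambda>z. disc_root (side j b1 b2) z) holomorphic_on {z. Im z < 0}" for j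
    using holomorphic_on_disc_root assms by (auto simp: side_def)
  have "vertex_denom_at b1 b2 holomorphic_on {z. Im z < 0}"
    unfolding vertex_denom_at_def[abs_def] vertex_denom_def
    using holomorphic_on_disc_root assms by (intro holomorphic_intros) auto
  moreover have "(\<lambda>z. dirichlet_kernel (side k b1 b2) (disc_root (side k b1 b2) z) n k)
      holomorphic_on {z. Im z < 0}"
    unfolding dirichlet_kernel_def by (intro holomorphic_intros)
  ultimately show ?thesis
    unfolding resolvent_def green_def side_disc_root vertex_denom_at_def[symmetric]
    using vertex_denom_at_nonzero assms
    by (cases "(n < 0) = (k < 0)") (auto intro!: holomorphic_intros)
qed

lemma continuous_on_resolvent:
  assumes "0 < b1" "0 < b2"
  shows "continuous_on {z. Im z \<le> 0 \<and> z \<noteq> 0} (\<lambda>z. resolvent b1 b2 z n k)"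
proof -
  have [continuous_intros]:
    "continuous_on {z. Im z \<le> 0 \<and> z \<noteq> 0} (\<lambda>z. disc_root (side j b1 b2) z)" for j
    using continuous_on_disc_root assms by (auto simp: side_def)
  have "continuous_on {z. Im z \<le> 0 \<and> z \<noteq> 0} (vertex_denom_at b1 b2)"
    unfolding vertex_denom_at_def[abs_def] vertex_denom_def
    using continuous_on_disc_root assms by (intro continuous_intros) auto
  moreover have "continuous_on {z. Im z \<le> 0 \<and> z \<noteq> 0}
      (\<lambda>z. dirichlet_kernel (side k b1 b2) (disc_root (side k b1 b2) z) n k)"
    unfolding dirichlet_kernel_def by (intro continuous_intros)
  ultimately show ?thesis
    unfolding resolvent_def green_def side_disc_root vertex_denom_at_def[symmetric]
    using vertex_denom_at_nonzero assms
    by (cases "(n < 0) = (k < 0)") (auto intro!: continuous_intros)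
qed

lemma disc_root_squared_ne_1:
  assumes "b \<noteq> 0" "z \<noteq> 0" "z \<noteq> of_real (- 4 / b\<^sup>2)"
  shows "(disc_root b z)\<^sup>2 \<noteq> 1"
proof
  assume "(disc_root b z)\<^sup>2 = 1"
  then consider "disc_root b z = 1" | "disc_root b z = -1" by (auto simp: power2_eq_1_iff)
  then show False
  proof cases
    case 1
    then have "2 / (disc_sqrt b z + 1) = 0" using one_minus_disc_root[of b z] by simp
    then show False by simp
  next
    case 2
    with disc_root_equation[OF assms(1,2)] have "- (z * of_real (b\<^sup>2)) = 4" by simp
    then have "z * of_real (b\<^sup>2) = - 4" by (metis minus_minus)
    then have "z = of_real (- 4 / b\<^sup>2)" using assms(1) by (simp add: field_simps)
    with assms(3) show False by simp
  qed
qed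

text \<open>
The excluded points are the edges of the spectra of the two half lines: a root equals \<open>-1\<close> at \<open>-4/b\<^sup>2\<close> and tends to
\<open>1\<close> at \<open>0\<close>.
\<close>

lemma A_seq_resolvent:
  assumes b: "0 < b1" "0 < b2" and z: "Im z \<le> 0"
    "z \<noteq> 0" "z \<noteq> of_real (- 4 / b1\<^sup>2)" "z \<noteq> of_real (- 4 / b2\<^sup>2)" and "k \<noteq> 0" "n \<noteq> 0"
  shows "A_seq b1 b2 (\<lambda>j. resolvent b1 b2 z j k) n
    = z * resolvent b1 b2 z n k + (if n = k then 1 else 0)"
  unfolding resolvent_def
  using assms vertex_denom_at_nonzero[OF b(1) z(1), of b2] unfolding vertex_denom_at_def
  by (intro A_seq_green disc_root_equation disc_root_squared_ne_1) auto

text \<open>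
Outside \<open>I\<close> both roots are real, so the kernel has no jump there.
\<close>

lemma resolvent_real:
  assumes "x \<notin> I_set b1 b2" "0 < b1" "0 < b2"
  shows "resolvent b1 b2 (of_real x) n k \<in> \<real>"
proof -
  have "disc_root b (of_real x) \<in> \<real>" if "b = b1 \<or> b = b2" for b
    using assms that by (intro disc_root_real) (auto simp: I_set_def max_def split: if_splits)
  then have "disc_root (side j b1 b2) (of_real x) \<in> \<real>" for j by (simp add: side_def)
  then have r: "disc_root b1 (of_real x) \<in> \<real>" "disc_root b2 (of_real x) \<in> \<real>"
    "\<And>j. disc_root (side j b1 b2) (of_real x) \<in> \<real>"
    using \<open>\<And>b. b = b1 \<or> b = b2 \<Longrightarrow> disc_root b (of_real x) \<in> \<real>\<close> by auto
  have "green b1 b2 (cnj (disc_root b1 (of_real x))) (cnj (disc_root b2 (of_real x))) n k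
      = green b1 b2 (disc_root b1 (of_real x)) (disc_root b2 (of_real x)) n k"
    using r(1,2) by (simp add: Reals_cnj_iff)
  then show ?thesis unfolding green_cnj resolvent_def by (simp add: Reals_cnj_iff)
qed

section \<open>Boundary integrals of functions on a half plane\<close>

lemma integrable_inverse_sqrt_abs:
  fixes L :: real
  shows "set_integrable lborel {- L..L} (\<lambda>x. 1 / sqrt \<bar>x\<bar>)"
proof (cases "0 \<le> L")
  case True
  define f where "f = (\<lambda>x::real. indicator {0..L} x *\<^sub>R (x powr (- 1 / 2)))"
  have [measurable]: "f \<in> borel_measurable lborel" unfolding f_def by measurable
  have "(\<lambda>x::real. x powr (- 1 / 2)) integrable_on {0..L}"
    using has_integral_powr_from_0[of "- 1 / 2" L] True by (auto simp: integrable_on_def)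
  then have "(\<lambda>x::real. x powr (- 1 / 2)) absolutely_integrable_on {0..L}"
    by (rule nonnegative_absolutely_integrable_1) auto
  then have f: "integrable lborel f"
    unfolding set_integrable_def f_def[symmetric] by (subst (asm) integrable_completion) auto
  have "integrable lborel (\<lambda>x. f (- x))"
    using lborel_integrable_real_affine[OF f, of "-1" 0] by simp
  from Bochner_Integration.integrable_add[OF f this]
  have "integrable lborel (\<lambda>x. f x + f (- x))" .
  \<comment> \<open>Both sides vanish at \<open>0\<close>, since \<open>0 powr a = 0\<close> and \<open>1 / 0 = 0\<close>.\<close>
  also have "(\<lambda>x. f x + f (- x)) = (\<lambda>x. indicator {- L..L} x *\<^sub>R (1 / sqrt \<bar>x\<bar>))"
    by (auto simp: fun_eq_iff f_def indicator_def powr_minus_divide powr_half_sqrt)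
  finally show ?thesis unfolding set_integrable_def .
qed (simp add: set_integrable_def)

text \<open>
A primitive exists because the half plane is convex. Its increment over the segment equals that along the other
three sides of the rectangle with depth \<open>L\<close>, on which \<open>|f| \<le> C/L\<^sup>2\<close>; their total length is at most \<open>4L\<close>.
\<close>

lemma half_plane_line_integral_bound:
  fixes f :: "complex \<Rightarrow> complex"
  assumes hol: "f holomorphic_on {z. Im z < 0}"
    and decay: "\<And>z. Im z < 0 \<Longrightarrow> 1 \<le> cmod z \<Longrightarrow> cmod (f z) \<le> C / (cmod z)\<^sup>2"
    and C: "0 \<le> C" and L: "1 \<le> L" and e: "0 < e" "e \<le> L"
  shows "cmod (LINT x:{- L..L}|lborel. f (Complex x (- e))) \<le> 4 * C / L"
proof -
  have "convex {z. Im z < 0}" "open {z. Im z < 0}"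
    by (simp_all add: convex_halfspace_Im_lt open_halfspace_Im_lt)
  from holomorphic_convex_primitive'[OF this hol] obtain G
    where G0: "\<And>z. Im z < 0 \<Longrightarrow> (G has_field_derivative f z) (at z within {z. Im z < 0})" by auto
  have G: "(G has_field_derivative f z) (at z)" if "Im z < 0" for z
    using G0[OF that] at_within_open[OF _ \<open>open {z. Im z < 0}\<close>, of z] that by simp
  have "(LINT x:{- L..L}|lborel. f (Complex x (- e))) = G (Complex L (- e)) - G (Complex (- L) (- e))"
    unfolding set_lebesgue_integral_def
  proof (rule integral_FTC_atLeastAtMost[where F = "\<lambda>x. G (Complex x (- e))"])
    show "continuous_on {- L..L} (\<lambda>x. f (Complex x (- e)))"
      by (rule continuous_on_compose2[OF holomorphic_on_imp_continuous_on[OF hol]])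
         (use e in \<open>auto intro!: continuous_intros\<close>)
    fix x
    have "((\<lambda>x. Complex x (- e)) has_vector_derivative 1) (at x)"
    proof -
      have "((\<lambda>x. of_real x + Complex 0 (- e)) has_vector_derivative 1) (at x)"
        by (auto intro!: derivative_eq_intros)
      also have "(\<lambda>x. of_real x + Complex 0 (- e)) = (\<lambda>x. Complex x (- e))"
        by (simp add: fun_eq_iff complex_eq_iff)
      finally show ?thesis .
    qed
    from field_vector_diff_chain_at[OF this G] e
    have "((\<lambda>x. G (Complex x (- e))) has_vector_derivative f (Complex x (- e))) (at x)"
      by (simp add: o_def)
    then show "((\<lambda>x. G (Complex x (- e))) has_vector_derivative f (Complex x (- e)))
        (at x within {- L..L})"
      by (rule has_vector_derivative_at_within)
  qed (use L in auto)
  moreover have segment: "cmod (G u - G v) \<le> C / L\<^sup>2 * d"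
    if S: "convex S" "\<And>z. z \<in> S \<Longrightarrow> Im z < 0 \<and> L \<le> cmod z" "u \<in> S" "v \<in> S" "cmod (u - v) \<le> d"
    for S u v d
  proof -
    have "cmod (G u - G v) \<le> C / L\<^sup>2 * cmod (u - v)"
    proof (rule field_differentiable_bound[OF S(1)])
      fix z assume "z \<in> S"
      with S(2) have z: "Im z < 0" "L \<le> cmod z" by auto
      show "(G has_field_derivative f z) (at z within S)"
        using G[OF z(1)] by (rule has_field_derivative_at_within)
      have "cmod (f z) \<le> C / (cmod z)\<^sup>2" using decay[OF z(1)] z(2) L by simp
      also have "\<dots> \<le> C / L\<^sup>2"
        using z L C order.strict_trans2[of 0 L "cmod z"]
        by (intro divide_left_mono power_mono mult_pos_pos zero_less_power) auto
      finally show "cmod (f z) \<le> C / L\<^sup>2" .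
    qed (use S in auto)
    also have "\<dots> \<le> C / L\<^sup>2 * d" using S(5) C by (intro mult_left_mono) auto
    finally show ?thesis .
  qed
  \<comment> \<open>The three sides of the rectangle away from the real line, each inside a convex set with \<open>L \<le> |z|\<close>.\<close>
  have "cmod (G (Complex L (- e)) - G (Complex L (- L))) \<le> C / L\<^sup>2 * L"
  proof (rule segment[where S = "{z. L \<le> Re z} \<inter> {z. Im z < 0}"])
    show "Im z < 0 \<and> L \<le> cmod z" if "z \<in> {z. L \<le> Re z} \<inter> {z. Im z < 0}" for z
      using that complex_Re_le_cmod[of z] by auto
  qed (use e L in \<open>auto intro!: convex_Int convex_halfspace_Im_lt convex_halfspace_Re_ge
    simp: cmod_def\<close>)
  moreover have "cmod (G (Complex L (- L)) - G (Complex (- L) (- L))) \<le> C / L\<^sup>2 * (2 * L)"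
  proof (rule segment[where S = "{z. Im z \<le> - L}"])
    show "Im z < 0 \<and> L \<le> cmod z" if "z \<in> {z. Im z \<le> - L}" for z
      using that abs_Im_le_cmod[of z] L by auto
  qed (use e L in \<open>auto intro!: convex_halfspace_Im_le
    simp: cmod_def real_sqrt_mult\<close>)
  moreover have "cmod (G (Complex (- L) (- L)) - G (Complex (- L) (- e))) \<le> C / L\<^sup>2 * L"
  proof (rule segment[where S = "{z. Re z \<le> - L} \<inter> {z. Im z < 0}"])
    show "Im z < 0 \<and> L \<le> cmod z" if "z \<in> {z. Re z \<le> - L} \<inter> {z. Im z < 0}" for z
      using that abs_Re_le_cmod[of z] L by auto
  qed (use e L in \<open>auto intro!: convex_Int convex_halfspace_Im_lt convex_halfspace_Re_le
    simp: cmod_def\<close>)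
  moreover have "C / L\<^sup>2 * L + C / L\<^sup>2 * (2 * L) + C / L\<^sup>2 * L = 4 * C / L"
    using L by (simp add: field_simps power2_eq_square)
  ultimately show ?thesis
    using norm_triangle_ineq[of "G (Complex L (- e)) - G (Complex L (- L))"
        "G (Complex L (- L)) - G (Complex (- L) (- L))"]
      norm_triangle_ineq[of "G (Complex L (- e)) - G (Complex (- L) (- L))"
        "G (Complex (- L) (- L)) - G (Complex (- L) (- e))"]
    by simp
qed

lemma borel_measurable_off_0:
  fixes g :: "real \<Rightarrow> 'a::{banach, second_countable_topology}"
  assumes "continuous_on (- {0}) g"
  shows "g \<in> borel_measurable lborel"
proof (rule measurable_discrete_difference[where X = "{0}"])
  show "(\<lambda>x. indicator (- {0}) x *\<^sub>R g x) \<in> borel_measurable lborel"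
    using borel_measurable_continuous_on_indicator[OF _ assms] by simp
qed (auto simp: indicator_def)

text \<open>
The bound in \<open>half_plane_line_integral_bound\<close> is uniform in the distance to the real line, so it persists in the
limit. The square root singularity at \<open>0\<close> is integrable and dominates the integrands of all parallel lines.
\<close>

lemma boundary_integral:
  fixes f :: "complex \<Rightarrow> complex"
  assumes hol: "f holomorphic_on {z. Im z < 0}"
    and cont: "continuous_on {z. Im z \<le> 0 \<and> z \<noteq> 0} f"
    and bound: "\<And>z. Im z \<le> 0 \<Longrightarrow> z \<noteq> 0 \<Longrightarrow> cmod (f z) \<le> M * (1 + 1 / sqrt (cmod z))"
    and M: "0 \<le> M"
  shows "set_integrable lborel {- L..L} (\<lambda>x. f (of_real x))"
    and "(\<And>z. Im z < 0 \<Longrightarrow> 1 \<le> cmod z \<Longrightarrow> cmod (f z) \<le> C / (cmod z)\<^sup>2) \<Longrightarrow> 0 \<le> C \<Longrightarrow> 1 \<le> L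
      \<Longrightarrow> cmod (LINT x:{- L..L}|lborel. f (of_real x)) \<le> 4 * C / L"
proof -
  define w where "w = (\<lambda>x. indicator {- L..L} x *\<^sub>R (M * (1 + 1 / sqrt \<bar>x\<bar>)))"
  define e where "e = (\<lambda>i. 1 / real (Suc i))"
  have e: "0 < e i" "e i \<le> 1" for i by (simp_all add: e_def)
  have "set_integrable lborel {- L..L} (\<lambda>x. M * (1 + 1 / sqrt \<bar>x\<bar>))"
    using integrable_inverse_sqrt_abs[of L] by (intro set_integrable_mult_right set_integral_add(1))
      (auto intro: borel_integrable_atLeastAtMost' continuous_intros)
  then have w: "integrable lborel w" by (simp add: w_def set_integrable_def)
  define s where "s = (\<lambda>i x. indicator {- L..L} x *\<^sub>R f (Complex x (- e i)))"
  define g where "g = (\<lambda>x::real. indicator {- L..L} x *\<^sub>R f (of_real x))"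
  have "continuous_on (- {0}) (\<lambda>x::real. f (of_real x))"
    by (rule continuous_on_compose2[OF cont]) (auto intro!: continuous_intros)
  from borel_measurable_off_0[OF this]
  have g[measurable]: "g \<in> borel_measurable lborel" unfolding g_def by measurable
  have s[measurable]: "s i \<in> borel_measurable lborel" for i
  proof -
    have "continuous_on UNIV (\<lambda>x. f (Complex x (- e i)))"
      by (rule continuous_on_compose2[OF cont])
         (use e[of i] in \<open>auto intro!: continuous_intros simp: complex_eq_iff\<close>)
    then have [measurable]: "(\<lambda>x. f (Complex x (- e i))) \<in> borel_measurable lborel"
      using borel_measurable_continuous_onI by auto
    show ?thesis unfolding s_def by measurable
  qed
  have bnd: "norm (s i x) \<le> w x" if "x \<noteq> 0" for i x
  proof -
    define z where "z = Complex x (- e i)"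
    have z: "Im z \<le> 0" "z \<noteq> 0" "\<bar>x\<bar> \<le> cmod z"
      using e[of i] that abs_Re_le_cmod[of z] by (auto simp: z_def complex_eq_iff)
    have "cmod (f z) \<le> M * (1 + 1 / sqrt (cmod z))" by (rule bound[OF z(1,2)])
    also have "\<dots> \<le> M * (1 + 1 / sqrt \<bar>x\<bar>)"
      using z(2,3) that M by (intro mult_left_mono add_mono divide_left_mono mult_pos_pos) auto
    finally show ?thesis by (simp add: s_def w_def z_def indicator_def)
  qed
  have lim: "(\<lambda>i. s i x) \<longlonglongrightarrow> g x" if "x \<noteq> 0" for x
  proof -
    have "filterlim e (at_right 0) sequentially"
      unfolding e_def by real_asymp
    from filterlim_compose[OF tendsto_lower_boundary[OF cont that] this]
    show ?thesis unfolding s_def g_def by (intro tendsto_intros)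
  qed
  have ae: "AE x in lborel. x \<noteq> (0::real)" by (rule AE_lborel_singleton)
  have lim': "AE x in lborel. (\<lambda>i. s i x) \<longlonglongrightarrow> g x" using ae by eventually_elim (rule lim)
  have bnd': "AE x in lborel. norm (s i x) \<le> w x" for i using ae by eventually_elim (rule bnd)
  show "set_integrable lborel {- L..L} (\<lambda>x. f (of_real x))"
    using integrable_dominated_convergence[OF g s w lim' bnd']
    by (simp add: set_integrable_def g_def)
  assume decay: "\<And>z. Im z < 0 \<Longrightarrow> 1 \<le> cmod z \<Longrightarrow> cmod (f z) \<le> C / (cmod z)\<^sup>2" and C: "0 \<le> C" and L: "1 \<le> L"
  have "(\<lambda>i. integral\<^sup>L lborel (s i)) \<longlonglongrightarrow> integral\<^sup>L lborel g"
    by (rule integral_dominated_convergence[OF g s w lim' bnd'])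
  then have "(\<lambda>i. cmod (integral\<^sup>L lborel (s i))) \<longlonglongrightarrow> cmod (integral\<^sup>L lborel g)"
    by (rule tendsto_norm)
  moreover have "cmod (integral\<^sup>L lborel (s i)) \<le> 4 * C / L" for i
    using half_plane_line_integral_bound[OF hol decay C L e(1)[of i]] e(2)[of i] L
    by (simp add: set_lebesgue_integral_def s_def)
  ultimately have "cmod (integral\<^sup>L lborel g) \<le> 4 * C / L"
    by (intro LIMSEQ_le_const2) auto
  then show "cmod (LINT x:{- L..L}|lborel. f (of_real x)) \<le> 4 * C / L"
    by (simp add: set_lebesgue_integral_def g_def)
qed

section \<open>Decay at infinity and completeness\<close>

text \<open>
From \<open>z b\<^sup>2 r = (1 - r)\<^sup>2\<close> and \<open>|r| \<le> 1\<close>.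
\<close>

lemma cmod_disc_root_decay:
  assumes "0 < b" "z \<noteq> 0"
  shows "cmod (disc_root b z) \<le> (4 / b\<^sup>2) / cmod z"
proof -
  define r where "r = disc_root b z"
  have "cmod z * b\<^sup>2 * cmod r = cmod (z * of_real (b\<^sup>2) * r)"
    by (simp add: norm_mult norm_power)
  also have "z * of_real (b\<^sup>2) * r = (1 - r)\<^sup>2"
    using disc_root_equation[of b z] assms by (simp add: r_def power2_eq_square algebra_simps)
  also have "cmod ((1 - r)\<^sup>2) \<le> 2\<^sup>2"
    unfolding norm_power
    using norm_triangle_ineq4[of 1 r] cmod_disc_root_le_1[of b z]
    by (intro power_mono) (auto simp: r_def)
  finally show ?thesis using assms unfolding r_def[symmetric] by (simp add: field_simps)
qed

text \<open>
The leading term of the diagonal kernel is \<open>b\<^sup>2 r = (1 - r)\<^sup>2/z\<close>, which is \<open>1/z\<close> up to \<open>O(|z|\<^sup>-\<^sup>2)\<close>. The comparison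
function \<open>1/(z - i)\<close> has the same leading term but no pole in the closed lower half plane.
\<close>

lemma dirichlet_kernel_diagonal_decay:
  assumes b: "0 < b" and z: "Im z \<le> 0" "1 \<le> cmod z" and n: "n \<noteq> 0"
  shows "cmod (1 / (z - \<i>) - dirichlet_kernel b (disc_root b z) n n)
    \<le> (1 + 12 / b\<^sup>2 + b\<^sup>2 * (4 / b\<^sup>2) ^ 2 * \<bar>of_int n\<bar>) / (cmod z)\<^sup>2"
proof -
  define r where "r = disc_root b z"
  define K where "K = 4 / b\<^sup>2"
  define m where "m = nat (\<bar>n\<bar>) - 1"
  have m: "nat (min \<bar>n\<bar> \<bar>n\<bar>) = Suc m" using n by (simp add: m_def)
  have z0: "z \<noteq> 0" "0 < cmod z" using z by auto
  have r1: "cmod r \<le> 1" by (simp add: r_def cmod_disc_root_le_1)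
  have rK: "cmod r \<le> K / cmod z" using cmod_disc_root_decay[OF b z0(1)] by (simp add: r_def K_def)
  have K: "0 \<le> K" by (simp add: K_def)
  have eq: "of_real (b\<^sup>2) * r = (1 - r)\<^sup>2 / z"
    using disc_root_equation[of b z] b z0 by (simp add: r_def power2_eq_square field_simps)
  define T where "T = of_real (b\<^sup>2) * r * r\<^sup>2 * (\<Sum>i<m. r ^ (2 * i))"
  have dk: "dirichlet_kernel b r n n = of_real (b\<^sup>2) * r + T"
    unfolding dirichlet_kernel_def m T_def sum.lessThan_Suc_shift
    by (simp add: power_add sum_distrib_left sum_distrib_right power2_eq_square algebra_simps)
  have zi: "z - \<i> \<noteq> 0" using z(1) by auto
  have "1 / z + \<i> / (z * (z - \<i>)) = (z - \<i>) / (z * (z - \<i>)) + \<i> / (z * (z - \<i>))"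
    using zi by simp
  also have "\<dots> = (z - \<i> + \<i>) / (z * (z - \<i>))" by (rule add_divide_distrib[symmetric])
  also have "\<dots> = 1 / (z - \<i>)" using z0 by simp
  finally have "1 / (z - \<i>) = 1 / z + \<i> / (z * (z - \<i>))" ..
  then have "1 / (z - \<i>) - dirichlet_kernel b r n n = \<i> / (z * (z - \<i>)) + (r * (2 - r)) / z - T"
    unfolding dk eq using z0 by (simp add: field_simps power2_eq_square)
  moreover have "cmod (\<i> / (z * (z - \<i>))) \<le> 1 / (cmod z)\<^sup>2"
  proof -
    have "(Im z)\<^sup>2 \<le> (Im z - 1)\<^sup>2" using z(1) by (simp add: power2_eq_square algebra_simps)
    then have "cmod z \<le> cmod (z - \<i>)" by (simp add: cmod_def)
    then have "1 / (cmod z * cmod (z - \<i>)) \<le> 1 / (cmod z * cmod z)"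
      using z0 by (intro divide_left_mono mult_left_mono mult_pos_pos) auto
    then show ?thesis by (simp add: norm_divide norm_mult power2_eq_square)
  qed
  moreover have "cmod ((r * (2 - r)) / z) \<le> 3 * K / (cmod z)\<^sup>2"
  proof -
    have "cmod (r * (2 - r)) \<le> K / cmod z * 3"
      unfolding norm_mult using rK r1 norm_triangle_ineq4[of 2 r] K by (intro mult_mono) auto
    then have "cmod (r * (2 - r)) / cmod z \<le> K / cmod z * 3 / cmod z"
      by (rule divide_right_mono) simp
    then show ?thesis by (simp add: norm_divide power2_eq_square mult.commute)
  qed
  moreover have "cmod T \<le> b\<^sup>2 * K\<^sup>2 * \<bar>of_int n\<bar> / (cmod z)\<^sup>2"
  proof -
    have "cmod (\<Sum>i<m. r ^ (2 * i)) \<le> (\<Sum>i<m. 1)"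
      using r1 by (intro sum_norm_le) (simp add: norm_power power_le_one)
    also have "\<dots> \<le> \<bar>of_int n\<bar>" by (simp add: m_def)
    finally have "cmod T \<le> b\<^sup>2 * 1 * (K / cmod z)\<^sup>2 * \<bar>of_int n\<bar>"
      unfolding T_def norm_mult norm_power
      using r1 rK by (intro mult_mono power_mono) (auto simp: norm_power)
    then show ?thesis by (simp add: power_divide)
  qed
  ultimately have "cmod (1 / (z - \<i>) - dirichlet_kernel b r n n)
      \<le> 1 / (cmod z)\<^sup>2 + 3 * K / (cmod z)\<^sup>2 + b\<^sup>2 * K\<^sup>2 * \<bar>of_int n\<bar> / (cmod z)\<^sup>2"
    using norm_triangle_ineq4[of "\<i> / (z * (z - \<i>)) + (r * (2 - r)) / z" T]
      norm_triangle_ineq[of "\<i> / (z * (z - \<i>))" "(r * (2 - r)) / z"] by simp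
  also have "\<dots> = (1 + 12 / b\<^sup>2 + b\<^sup>2 * (4 / b\<^sup>2) ^ 2 * \<bar>of_int n\<bar>) / (cmod z)\<^sup>2"
    by (simp add: K_def add_divide_distrib)
  finally show ?thesis by (simp only: r_def)
qed

text \<open>
Off the diagonal, and in the term coming from the junction, at least two factors \<open>r = O(1/|z|)\<close> occur.
\<close>

lemma resolvent_decay:
  assumes b: "0 < b1" "0 < b2" and nk: "n \<noteq> 0" "k \<noteq> 0"
  obtains C where "0 \<le> C" "\<And>z. Im z \<le> 0 \<Longrightarrow> 1 \<le> cmod z \<Longrightarrow>
    cmod (resolvent b1 b2 z n k + (if n = k then 1 else 0) / (z - \<i>)) \<le> C / (cmod z)\<^sup>2"
proof
  define K where "K = 4 / b1\<^sup>2 + 4 / b2\<^sup>2"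
  define B where "B = side k b1 b2"
  define C1 where "C1 = K\<^sup>2 * (b1\<^sup>2 + b1)"
  define C2 where "C2 = (if n = k then 1 + 12 / B\<^sup>2 + B\<^sup>2 * (4 / B\<^sup>2) ^ 2 * \<bar>of_int n\<bar>
    else B\<^sup>2 * K\<^sup>2 * \<bar>of_int n\<bar>)"
  have B: "0 < B" using b by (simp add: B_def side_def)
  have C2: "0 \<le> C2" using B by (auto simp: C2_def)
  show "0 \<le> C1 + C2" using b C2 by (simp add: C1_def)
  fix z assume z: "Im z \<le> 0" "1 \<le> cmod z"
  then have z0: "z \<noteq> 0" "0 < cmod z" by auto
  define r where "r = (\<lambda>j. disc_root (side j b1 b2) z)"
  have r1: "cmod (r j) \<le> 1" for j by (simp add: r_def cmod_disc_root_le_1)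
  have K: "0 \<le> K" by (simp add: K_def)
  have rK: "cmod (r j) \<le> K / cmod z" for j
  proof -
    have "cmod (r j) \<le> (4 / (side j b1 b2)\<^sup>2) / cmod z"
      unfolding r_def by (rule cmod_disc_root_decay) (use b z0 in \<open>auto simp: side_def\<close>)
    also have "\<dots> \<le> K / cmod z" by (intro divide_right_mono) (auto simp: K_def side_def)
    finally show ?thesis .
  qed
  define D where "D = vertex_denom_at b1 b2 z"
  define H where "H = (if (n < 0) = (k < 0) then dirichlet_kernel B (r k) n k else 0)"
  have res: "resolvent b1 b2 z n k = - (r n ^ nat \<bar>n\<bar> * r k ^ nat \<bar>k\<bar> / D) - H"
    unfolding resolvent_def green_def side_disc_root r_def H_def D_def vertex_denom_at_def B_def ..
  have pw: "cmod (r j) ^ nat \<bar>j\<bar> \<le> K / cmod z" if "j \<noteq> 0" for j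
  proof -
    have "cmod (r j) ^ nat \<bar>j\<bar> \<le> cmod (r j) ^ 1"
      using that r1 by (intro power_decreasing) auto
    then show ?thesis using rK[of j] by simp
  qed
  have first: "cmod (r n ^ nat \<bar>n\<bar> * r k ^ nat \<bar>k\<bar> / D) \<le> C1 / (cmod z)\<^sup>2"
  proof -
    have "b1 / sqrt (cmod z) \<le> b1 / 1" using z b by (intro divide_left_mono) auto
    then have "1 / cmod D \<le> b1\<^sup>2 + b1"
      using inverse_vertex_denom_at_bound[OF b(1) z(1), of b2] by (simp add: D_def)
    then have "cmod (r n) ^ nat \<bar>n\<bar> * cmod (r k) ^ nat \<bar>k\<bar> * (1 / cmod D)
        \<le> (K / cmod z) * (K / cmod z) * (b1\<^sup>2 + b1)"
      using pw nk K z0 b by (intro mult_mono) auto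
    then show ?thesis by (simp add: C1_def norm_mult norm_divide norm_power power2_eq_square)
  qed
  have second: "cmod ((if n = k then 1 else 0) / (z - \<i>) - H) \<le> C2 / (cmod z)\<^sup>2"
  proof (cases "n = k")
    case True
    then show ?thesis
      using dirichlet_kernel_diagonal_decay[OF B z nk(1)]
      by (simp add: H_def C2_def r_def B_def)
  next
    case False
    have "cmod (dirichlet_kernel B (r k) n k) \<le> B\<^sup>2 * cmod (r k) ^ (nat \<bar>n - k\<bar> + 1) * \<bar>of_int n\<bar>"
      by (rule cmod_dirichlet_kernel_le[OF r1])
    also have "\<dots> \<le> B\<^sup>2 * (K / cmod z)\<^sup>2 * \<bar>of_int n\<bar>"
    proof (intro mult_right_mono mult_left_mono)
      have "cmod (r k) ^ (nat \<bar>n - k\<bar> + 1) \<le> cmod (r k) ^ 2"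
        using False r1 by (intro power_decreasing) auto
      also have "\<dots> \<le> (K / cmod z)\<^sup>2" using rK by (intro power_mono) auto
      finally show "cmod (r k) ^ (nat \<bar>n - k\<bar> + 1) \<le> (K / cmod z)\<^sup>2" .
    qed auto
    also have "\<dots> = C2 / (cmod z)\<^sup>2" using False by (simp add: C2_def power_divide)
    finally have "cmod (dirichlet_kernel B (r k) n k) \<le> C2 / (cmod z)\<^sup>2" .
    moreover have "0 \<le> C2 / (cmod z)\<^sup>2" using C2 by simp
    ultimately show ?thesis using False by (auto simp: H_def)
  qed
  have "resolvent b1 b2 z n k + (if n = k then 1 else 0) / (z - \<i>)
      = - (r n ^ nat \<bar>n\<bar> * r k ^ nat \<bar>k\<bar> / D) + ((if n = k then 1 else 0) / (z - \<i>) - H)"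
    by (simp add: res)
  then have "cmod (resolvent b1 b2 z n k + (if n = k then 1 else 0) / (z - \<i>))
      \<le> C1 / (cmod z)\<^sup>2 + C2 / (cmod z)\<^sup>2"
    using norm_triangle_ineq[of "- (r n ^ nat \<bar>n\<bar> * r k ^ nat \<bar>k\<bar> / D)"
        "(if n = k then 1 else 0) / (z - \<i>) - H"] first second
    by (simp only: norm_minus_cancel)
  then show "cmod (resolvent b1 b2 z n k + (if n = k then 1 else 0) / (z - \<i>)) \<le> (C1 + C2) / (cmod z)\<^sup>2"
    by (simp add: add_divide_distrib)
qed

lemma resolvent_bound:
  assumes b: "0 < b1" "0 < b2"
  obtains M where "0 \<le> M" "\<And>z k. Im z \<le> 0 \<Longrightarrow> z \<noteq> 0 \<Longrightarrow>
    cmod (resolvent b1 b2 z n k) \<le> M * (1 + 1 / sqrt (cmod z))"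
proof
  define M where "M = b1\<^sup>2 + b1 + (b1\<^sup>2 + b2\<^sup>2) * \<bar>of_int n\<bar>"
  show "0 \<le> M" using b by (simp add: M_def)
  fix z k assume z: "Im z \<le> 0" "z \<noteq> 0"
  define a where "a = 1 / sqrt (cmod z)"
  define N where "N = (b1\<^sup>2 + b2\<^sup>2) * \<bar>real_of_int n\<bar>"
  have a: "0 \<le> a" "0 \<le> N" by (simp_all add: a_def N_def)
  have "cmod (resolvent b1 b2 z n k) \<le> b1\<^sup>2 + b1 * a + N"
    using cmod_resolvent_le[OF b(1) z(1), of b2 n k] by (simp add: a_def N_def)
  also have "\<dots> \<le> (b1\<^sup>2 + b1 + N) * (1 + a)"
    using a b by (simp add: algebra_simps)
  finally show "cmod (resolvent b1 b2 z n k) \<le> M * (1 + 1 / sqrt (cmod z))"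
    by (simp add: M_def a_def N_def)
qed

lemma integral_inverse_minus_i:
  assumes "0 \<le> L"
  shows "set_integrable lborel {- L..L} (\<lambda>x. 1 / (of_real x - \<i>))"
    and "Im (LINT x:{- L..L}|lborel. 1 / (of_real x - \<i>)) = 2 * arctan L"
proof -
  have nz: "of_real x - \<i> \<noteq> 0" for x by (simp add: complex_eq_iff)
  show int: "set_integrable lborel {- L..L} (\<lambda>x. 1 / (of_real x - \<i>))"
    using nz by (intro borel_integrable_atLeastAtMost' continuous_intros) auto
  have "Im (LINT x:{- L..L}|lborel. 1 / (of_real x - \<i>))
      = (LINT x:{- L..L}|lborel. Im (1 / (of_real x - \<i>)))"
    using int unfolding set_lebesgue_integral_def set_integrable_def
    by (subst integral_Im[symmetric]) simp_all
  also have "\<dots> = (LINT x:{- L..L}|lborel. 1 / (1 + x\<^sup>2))"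
    by (simp add: Im_divide add.commute)
  also have "\<dots> = arctan L - arctan (- L)"
    unfolding set_lebesgue_integral_def
  proof (rule integral_FTC_atLeastAtMost)
    show "continuous_on {- L..L} (\<lambda>x. 1 / (1 + x\<^sup>2))"
      by (intro continuous_intros) (simp add: add_nonneg_eq_0_iff)
    show "(arctan has_vector_derivative 1 / (1 + x\<^sup>2)) (at x within {- L..L})" for x
      using DERIV_arctan[of x]
      by (simp add: has_real_derivative_iff_has_vector_derivative[symmetric]
          inverse_eq_divide has_field_derivative_at_within)
  qed (use assms in auto)
  finally show "Im (LINT x:{- L..L}|lborel. 1 / (of_real x - \<i>)) = 2 * arctan L"
    by (simp add: arctan_minus)
qed

lemma I_set_subset: "\<exists>L0\<ge>0. I_set b1 b2 \<subseteq> {- L0..L0}"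
  by (rule exI[of _ "4 * max (1 / b1\<^sup>2) (1 / b2\<^sup>2)"]) (auto simp: I_set_def le_max_iff_disj)

lemma set_integrable_resolvent:
  assumes b: "0 < b1" "0 < b2"
  shows "set_integrable lborel {- L..L} (\<lambda>x. resolvent b1 b2 (of_real x) n k)"
proof -
  obtain M where M: "0 \<le> M" "\<And>z k. Im z \<le> 0 \<Longrightarrow> z \<noteq> 0 \<Longrightarrow>
    cmod (resolvent b1 b2 z n k) \<le> M * (1 + 1 / sqrt (cmod z))" using resolvent_bound[OF b, of n] by blast
  show ?thesis
    by (rule boundary_integral(1)[OF holomorphic_on_resolvent[OF b] continuous_on_resolvent[OF b] M(2,1)])
qed

lemma integral_Im_resolvent_symmetric:
  assumes b: "0 < b1" "0 < b2" and nk: "n \<noteq> 0" "k \<noteq> 0"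
  obtains C where "\<And>L. 1 \<le> L \<Longrightarrow>
    \<bar>Im (LINT x:{- L..L}|lborel. resolvent b1 b2 (of_real x) n k)
      + (if n = k then 2 * arctan L else 0)\<bar> \<le> 4 * C / L"
proof -
  obtain M where M: "0 \<le> M" "\<And>z k. Im z \<le> 0 \<Longrightarrow> z \<noteq> 0 \<Longrightarrow>
    cmod (resolvent b1 b2 z n k) \<le> M * (1 + 1 / sqrt (cmod z))" using resolvent_bound[OF b, of n] by blast
  obtain C where C: "0 \<le> C" "\<And>z. Im z \<le> 0 \<Longrightarrow> 1 \<le> cmod z \<Longrightarrow>
    cmod (resolvent b1 b2 z n k + (if n = k then 1 else 0) / (z - \<i>)) \<le> C / (cmod z)\<^sup>2"
    using resolvent_decay[OF b nk] by blast
  define \<delta> :: complex where "\<delta> = (if n = k then 1 else 0)"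
  define f where "f = (\<lambda>z. resolvent b1 b2 z n k + \<delta> / (z - \<i>))"
  have hol: "f holomorphic_on {z. Im z < 0}"
    unfolding f_def using holomorphic_on_resolvent[OF b]
    by (intro holomorphic_intros) auto
  have cont: "continuous_on {z. Im z \<le> 0 \<and> z \<noteq> 0} f"
    unfolding f_def using continuous_on_resolvent[OF b]
    by (intro continuous_intros) auto
  have bound: "cmod (f z) \<le> (M + 1) * (1 + 1 / sqrt (cmod z))" if z: "Im z \<le> 0" "z \<noteq> 0" for z
  proof -
    have "1 \<le> cmod (z - \<i>)" using abs_Im_le_cmod[of "z - \<i>"] z by simp
    then have "cmod (\<delta> / (z - \<i>)) \<le> 1" by (auto simp: \<delta>_def norm_divide divide_le_eq_1)
    also have "\<dots> \<le> 1 * (1 + 1 / sqrt (cmod z))" by simp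
    finally show ?thesis
      using norm_triangle_ineq[of "resolvent b1 b2 z n k" "\<delta> / (z - \<i>)"] M(2)[OF z, of k]
      unfolding f_def distrib_right[of M 1] by linarith
  qed
  show thesis
  proof (rule that)
    fix L :: real assume L: "1 \<le> L"
    have "cmod (LINT x:{- L..L}|lborel. f (of_real x)) \<le> 4 * C / L"
      by (rule boundary_integral(2)[OF hol cont bound _ _ C(1) L])
         (use M C(2) in \<open>auto simp: f_def \<delta>_def\<close>)
    moreover have "(LINT x:{- L..L}|lborel. f (of_real x))
        = (LINT x:{- L..L}|lborel. resolvent b1 b2 (of_real x) n k)
          + \<delta> * (LINT x:{- L..L}|lborel. 1 / (of_real x - \<i>))"
    proof -
      have "set_integrable lborel {- L..L} (\<lambda>x. \<delta> * (1 / (of_real x - \<i>)))"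
        using integral_inverse_minus_i(1)[of L] L by (intro set_integrable_mult_right) auto
      from set_integral_add(2)[OF set_integrable_resolvent[OF b] this]
      show ?thesis
        by (simp only: f_def set_integral_mult_right[symmetric]) simp
    qed
    moreover have "Im (\<delta> * (LINT x:{- L..L}|lborel. 1 / (of_real x - \<i>)))
        = (if n = k then 2 * arctan L else 0)"
      using integral_inverse_minus_i(2)[of L] L by (simp add: \<delta>_def)
    ultimately show "\<bar>Im (LINT x:{- L..L}|lborel. resolvent b1 b2 (of_real x) n k)
        + (if n = k then 2 * arctan L else 0)\<bar> \<le> 4 * C / L"
      using abs_Im_le_cmod[of "LINT x:{- L..L}|lborel. f (of_real x)"] by simp
  qed
qed

text \<open>
Completeness, in terms of the kernel. The imaginary part of the integral over \<open>[-L, L]\<close> is constant as soon as the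
interval contains \<open>I\<close>, whereas \<open>2 arctan L\<close> tends to \<open>\<pi>\<close>.
\<close>

lemma integral_Im_resolvent:
  assumes b: "0 < b1" "0 < b2" and nk: "n \<noteq> 0" "k \<noteq> 0"
  shows "(LINT x:I_set b1 b2|lborel. Im (resolvent b1 b2 (of_real x) n k)) = (if n = k then - pi else 0)"
proof -
  define J where "J = (LINT x:I_set b1 b2|lborel. Im (resolvent b1 b2 (of_real x) n k))"
  obtain L0 where L0: "I_set b1 b2 \<subseteq> {- L0..L0}" using I_set_subset by blast
  have eq: "Im (LINT x:{- L..L}|lborel. resolvent b1 b2 (of_real x) n k) = J" if "L0 \<le> L" for L
  proof -
    have "Im (LINT x:{- L..L}|lborel. resolvent b1 b2 (of_real x) n k)
        = (LINT x:{- L..L}|lborel. Im (resolvent b1 b2 (of_real x) n k))"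
      using set_integrable_resolvent[OF b] unfolding set_lebesgue_integral_def set_integrable_def
      by (subst integral_Im[symmetric]) simp_all
    also have "\<dots> = J"
      unfolding J_def set_lebesgue_integral_def
    proof (intro Bochner_Integration.integral_cong refl)
      fix x
      have "Im (resolvent b1 b2 (of_real x) n k) = 0" if "x \<notin> I_set b1 b2"
        using resolvent_real[OF that b] by (auto simp: complex_is_Real_iff)
      moreover have "{- L0..L0} \<subseteq> {- L..L}" using that by auto
      ultimately show "indicat_real {- L..L} x *\<^sub>R Im (resolvent b1 b2 (of_real x) n k)
          = indicat_real (I_set b1 b2) x *\<^sub>R Im (resolvent b1 b2 (of_real x) n k)"
        using L0 by (auto simp: indicator_def)
    qed
    finally show ?thesis .
  qed
  obtain C where C: "\<And>L. 1 \<le> L \<Longrightarrow>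
    \<bar>Im (LINT x:{- L..L}|lborel. resolvent b1 b2 (of_real x) n k)
      + (if n = k then 2 * arctan L else 0)\<bar> \<le> 4 * C / L"
    using integral_Im_resolvent_symmetric[OF b nk] by blast
  have "((\<lambda>L. J + (if n = k then 2 * arctan L else 0)) \<longlongrightarrow> 0) at_top"
  proof (rule Lim_null_comparison)
    show "\<forall>\<^sub>F L in at_top. norm (J + (if n = k then 2 * arctan L else 0)) \<le> 4 * C / L"
      using eventually_ge_at_top[of "max 1 L0"] by eventually_elim (use C eq in force)
    show "((\<lambda>L. 4 * C / L) \<longlongrightarrow> 0) at_top" by real_asymp
  qed
  moreover have "((\<lambda>L. J + (if n = k then 2 * arctan L else 0))
      \<longlongrightarrow> J + (if n = k then 2 * (pi / 2) else 0)) at_top"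
    using tendsto_mult[OF tendsto_const[of 2] tendsto_arctan_at_top]
    by (cases "n = k") (auto intro!: tendsto_add)
  ultimately have "J + (if n = k then 2 * (pi / 2) else 0) = 0"
    using tendsto_unique trivial_limit_at_top_linorder by blast
  then show ?thesis unfolding J_def by (auto split: if_splits)
qed

section \<open>The resolvent_jump of the resolvent as an integrable spectral_density\<close>

text \<open>
Dividing by \<open>r - r\<^sup>-\<^sup>1\<close> gives back the geometric sum of the half line kernel only if \<open>r\<close> is neither \<open>0\<close> nor \<open>\<plusminus>1\<close>.
\<close>

lemma has_sum_green:
  assumes r: "cmod r1 \<le> 1" "cmod r2 \<le> 1" "r1\<^sup>2 \<noteq> 1" "r2\<^sup>2 \<noteq> 1" "r1 \<noteq> 0" "r2 \<noteq> 0"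
    and lim: "r_lim \<sigma> b1 \<omega> = r1" "r_lim \<sigma> b2 \<omega> = r2"
    and \<phi>: "(\<lambda>k. cmod (\<phi> k)) summable_on Zstar" and n: "n \<noteq> 0"
  shows "((\<lambda>k. green b1 b2 r1 r2 n k * \<phi> k) has_sum R_op \<sigma> b1 b2 \<omega> \<phi> n) Zstar"
proof -
  define r where "r = side n r1 r2"
  define b where "b = side n b1 b2"
  define Z :: "int set" where "Z = (if n < 0 then {..-1} else {1..})"
  have Z: "Z \<subseteq> Zstar" by (auto simp: Z_def)
  have r': "cmod r \<le> 1" "r\<^sup>2 \<noteq> 1" "r \<noteq> 0" using r by (auto simp: r_def side_def)
  have Zstar: "Zstar = {..-1} \<union> {1..}" by auto
  have summable: "(\<lambda>k. c k * \<phi> k) summable_on S" if "S \<subseteq> Zstar" "\<And>k. cmod (c k) \<le> B" for S c B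
  proof (rule abs_summable_summable, rule summable_on_comparison_test)
    show "(\<lambda>k. B * cmod (\<phi> k)) summable_on S"
      using summable_on_subset_banach[OF \<phi> that(1)] by (rule summable_on_cmult_right)
  qed (auto simp: norm_mult intro!: mult_right_mono that)
  define P where "P = (\<lambda>k. side k r1 r2 ^ nat \<bar>k\<bar>)"
  define S1 where "S1 = (\<Sum>\<^sub>\<infinity>k\<in>{..-1}. r1 ^ nat \<bar>k\<bar> * \<phi> k)"
  define S2 where "S2 = (\<Sum>\<^sub>\<infinity>k\<in>{1..}. r2 ^ nat \<bar>k\<bar> * \<phi> k)"
  have "((\<lambda>k. r1 ^ nat \<bar>k\<bar> * \<phi> k) has_sum S1) {..-1}"
    unfolding S1_def
    by (intro has_sum_infsum summable[where B = 1]) (auto simp: norm_power power_le_one r)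
  then have 1: "((\<lambda>k. P k * \<phi> k) has_sum S1) {..-1}"
    by (rule has_sum_cong[THEN iffD1, rotated]) (auto simp: P_def)
  have "((\<lambda>k. r2 ^ nat \<bar>k\<bar> * \<phi> k) has_sum S2) {1..}"
    unfolding S2_def
    by (intro has_sum_infsum summable[where B = 1]) (auto simp: norm_power power_le_one r)
  then have 2: "((\<lambda>k. P k * \<phi> k) has_sum S2) {1..}"
    by (rule has_sum_cong[THEN iffD1, rotated]) (auto simp: P_def)
  have "((\<lambda>k. P k * \<phi> k) has_sum (S1 + S2)) Zstar"
    unfolding Zstar by (rule has_sum_Un_disjoint[OF 1 2]) auto
  from has_sum_cmult_right[OF this, of "- (r ^ nat \<bar>n\<bar>) / vertex_denom b1 b2 r1 r2"]
  have A: "((\<lambda>k. - (r ^ nat \<bar>n\<bar>) / vertex_denom b1 b2 r1 r2 * (P k * \<phi> k))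
      has_sum - (r ^ nat \<bar>n\<bar>) / vertex_denom b1 b2 r1 r2 * (S1 + S2)) Zstar" .
  define E where "E = (\<lambda>k. r ^ nat \<bar>n - k\<bar> - r ^ (nat \<bar>n\<bar> + nat \<bar>k\<bar>))"
  define S3 where "S3 = (\<Sum>\<^sub>\<infinity>k\<in>Z. E k * \<phi> k)"
  have "cmod (E k) \<le> 2" for k
  proof -
    have "cmod (E k) \<le> cmod r ^ nat \<bar>n - k\<bar> + cmod r ^ (nat \<bar>n\<bar> + nat \<bar>k\<bar>)"
      unfolding E_def norm_power[symmetric] by (rule norm_triangle_ineq4)
    also have "\<dots> \<le> 1 + 1" using r' by (intro add_mono power_le_one) auto
    finally show ?thesis by simp
  qed
  then have "((\<lambda>k. E k * \<phi> k) has_sum S3) Z"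
    unfolding S3_def by (intro has_sum_infsum summable[OF Z])
  from has_sum_cmult_right[OF this, of "of_real (b\<^sup>2) / (r - 1 / r)"]
  have B0: "((\<lambda>k. of_real (b\<^sup>2) / (r - 1 / r) * (E k * \<phi> k))
      has_sum of_real (b\<^sup>2) / (r - 1 / r) * S3) Z" .
  have "r - 1 / r = - ((1 - r\<^sup>2) / r)"
    using r'(3) by (simp add: diff_divide_distrib power2_eq_square)
  then have coeff: "of_real (b\<^sup>2) / (r - 1 / r) = - (of_real (b\<^sup>2) * r / (1 - r\<^sup>2))"
    by (simp only: divide_minus_right divide_divide_eq_right)
  have dk: "of_real (b\<^sup>2) / (r - 1 / r) * (E k * \<phi> k) = - dirichlet_kernel b r n k * \<phi> k" if "k \<in> Z" for k
  proof -
    have "0 \<le> n * k" using that n by (auto simp: Z_def zero_le_mult_iff split: if_splits)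
    then show ?thesis
      unfolding coeff using dirichlet_kernel_closed_form[OF r'(2), of n k b] by (simp add: E_def)
  qed
  have B: "((\<lambda>k. (if k \<in> Z then - dirichlet_kernel b r n k else 0) * \<phi> k)
      has_sum of_real (b\<^sup>2) / (r - 1 / r) * S3) Zstar"
    by (rule has_sum_cong_neutral[THEN iffD1, OF _ _ _ B0]) (use Z dk in auto)
  have "R_op \<sigma> b1 b2 \<omega> \<phi> n = - (r ^ nat \<bar>n\<bar>) / vertex_denom b1 b2 r1 r2 * (S1 + S2)
      + of_real (b\<^sup>2) / (r - 1 / r) * S3"
    unfolding R_op_def Let_def lim S1_def S2_def S3_def E_def r_def b_def Z_def
      side_def vertex_denom_def ..
  moreover have green_eq: "- (r ^ nat \<bar>n\<bar>) / vertex_denom b1 b2 r1 r2 * (P k * \<phi> k)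
      + (if k \<in> Z then - dirichlet_kernel b r n k else 0) * \<phi> k = green b1 b2 r1 r2 n k * \<phi> k"
    if "k \<in> Zstar" for k
  proof -
    have Z_iff: "k \<in> Z \<longleftrightarrow> (n < 0) = (k < 0)" using that n by (auto simp: Z_def)
    show ?thesis
    proof (cases "k \<in> Z")
      case True
      then have side: "side k b1 b2 = b" "side k r1 r2 = r"
        using Z_iff by (auto simp: b_def r_def side_def)
      have "green b1 b2 r1 r2 n k
          = - (r ^ nat \<bar>n\<bar> * P k / vertex_denom b1 b2 r1 r2) - dirichlet_kernel b r n k"
        using True Z_iff unfolding green_def side P_def r_def[symmetric] by simp
      then show ?thesis using True by (simp add: distrib_right left_diff_distrib)
    next
      case False
      then have "green b1 b2 r1 r2 n k = - (r ^ nat \<bar>n\<bar> * P k / vertex_denom b1 b2 r1 r2)"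
        using Z_iff unfolding green_def P_def r_def[symmetric] by simp
      then show ?thesis using False by simp
    qed
  qed
  moreover have "((\<lambda>k. green b1 b2 r1 r2 n k * \<phi> k) has_sum
      - (r ^ nat \<bar>n\<bar>) / vertex_denom b1 b2 r1 r2 * (S1 + S2) + of_real (b\<^sup>2) / (r - 1 / r) * S3) Zstar"
    by (rule has_sum_cong[THEN iffD1, OF _ has_sum_add[OF A B]]) (rule green_eq)
  ultimately show ?thesis by (simp only:)
qed

text \<open>
The upper boundary value is the complex conjugate of the lower one.
\<close>

definition resolvent_jump :: "real \<Rightarrow> real \<Rightarrow> real \<Rightarrow> int \<Rightarrow> int \<Rightarrow> complex" where
  "resolvent_jump b1 b2 \<omega> n k = cnj (resolvent b1 b2 (of_real \<omega>) n k) - resolvent b1 b2 (of_real \<omega>) n k"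

text \<open>
The spectral density of \<open>A\<close> applied to \<open>\<phi>\<close>, multiplied by \<open>2\<pi>i\<close>.
\<close>

definition spectral_density :: "real \<Rightarrow> real \<Rightarrow> (int \<Rightarrow> complex) \<Rightarrow> real \<Rightarrow> int \<Rightarrow> complex" where
  "spectral_density b1 b2 \<phi> \<omega> n = (\<Sum>\<^sub>\<infinity>k\<in>Zstar. resolvent_jump b1 b2 \<omega> n k * \<phi> k)"

lemma resolvent_jump_bound:
  assumes b: "0 < b1" "0 < b2"
  obtains M where "0 \<le> M" "\<And>\<omega> k. \<omega> \<noteq> 0 \<Longrightarrow> cmod (resolvent_jump b1 b2 \<omega> n k) \<le> M * (1 + 1 / sqrt \<bar>\<omega>\<bar>)"
proof -
  obtain M where M: "0 \<le> M" "\<And>z k. Im z \<le> 0 \<Longrightarrow> z \<noteq> 0 \<Longrightarrow>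
    cmod (resolvent b1 b2 z n k) \<le> M * (1 + 1 / sqrt (cmod z))" using resolvent_bound[OF b, of n] by blast
  show thesis
  proof (rule that[of "2 * M"])
    fix \<omega> :: real and k assume "\<omega> \<noteq> 0"
    then show "cmod (resolvent_jump b1 b2 \<omega> n k) \<le> 2 * M * (1 + 1 / sqrt \<bar>\<omega>\<bar>)"
      unfolding resolvent_jump_def
      using norm_triangle_ineq4[of "cnj (resolvent b1 b2 (of_real \<omega>) n k)" "resolvent b1 b2 (of_real \<omega>) n k"]
        M(2)[of "of_real \<omega>" k] by simp
  qed (use M(1) in simp)
qed

lemma has_sum_spectral_density:
  assumes b: "0 < b1" "0 < b2" and \<phi>: "(\<lambda>k. cmod (\<phi> k)) summable_on Zstar" and "\<omega> \<noteq> 0"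
  shows "((\<lambda>k. resolvent_jump b1 b2 \<omega> n k * \<phi> k) has_sum spectral_density b1 b2 \<phi> \<omega> n) Zstar"
proof -
  obtain M where M: "0 \<le> M" "\<And>\<omega> k. \<omega> \<noteq> 0 \<Longrightarrow> cmod (resolvent_jump b1 b2 \<omega> n k) \<le> M * (1 + 1 / sqrt \<bar>\<omega>\<bar>)"
    using resolvent_jump_bound[OF b, of n] by blast
  show ?thesis
    unfolding spectral_density_def
  proof (rule has_sum_infsum, rule abs_summable_summable, rule summable_on_comparison_test)
    show "(\<lambda>k. M * (1 + 1 / sqrt \<bar>\<omega>\<bar>) * cmod (\<phi> k)) summable_on Zstar"
      using \<phi> by (rule summable_on_cmult_right)
    show "norm (resolvent_jump b1 b2 \<omega> n k * \<phi> k) \<le> M * (1 + 1 / sqrt \<bar>\<omega>\<bar>) * cmod (\<phi> k)" for k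
      unfolding norm_mult using M(2)[OF \<open>\<omega> \<noteq> 0\<close>] by (rule mult_right_mono) simp
  qed simp
qed

lemma R_op_difference_eq_spectral_density:
  assumes b: "0 < b1" "0 < b2" and \<phi>: "(\<lambda>k. cmod (\<phi> k)) summable_on Zstar" and n: "n \<noteq> 0"
    and \<omega>: "\<omega> \<noteq> 0" "\<omega> \<noteq> - 4 / b1\<^sup>2" "\<omega> \<noteq> - 4 / b2\<^sup>2"
  shows "R_op 1 b1 b2 \<omega> \<phi> n - R_op (-1) b1 b2 \<omega> \<phi> n = spectral_density b1 b2 \<phi> \<omega> n"
proof -
  define r1 where "r1 = disc_root b1 (of_real \<omega>)"
  define r2 where "r2 = disc_root b2 (of_real \<omega>)"
  have \<omega>': "complex_of_real \<omega> \<noteq> 0" "complex_of_real \<omega> \<noteq> of_real (- 4 / b1\<^sup>2)"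
    "complex_of_real \<omega> \<noteq> of_real (- 4 / b2\<^sup>2)"
    by (simp_all only: of_real_eq_iff of_real_eq_0_iff \<omega> not_False_eq_True)
  have b': "b1 \<noteq> 0" "b2 \<noteq> 0" using b by auto
  have sq: "r1\<^sup>2 \<noteq> 1" "r2\<^sup>2 \<noteq> 1"
    unfolding r1_def r2_def by (intro disc_root_squared_ne_1 b' \<omega>')+
  have nz: "r1 \<noteq> 0" "r2 \<noteq> 0"
    unfolding r1_def r2_def by (intro disc_root_nonzero b' \<omega>')+
  have le: "cmod r1 \<le> 1" "cmod r2 \<le> 1" by (simp_all add: r1_def r2_def cmod_disc_root_le_1)
  have sq': "(cnj r1)\<^sup>2 \<noteq> 1" "(cnj r2)\<^sup>2 \<noteq> 1"
    using sq by (metis complex_cnj_cnj complex_cnj_one complex_cnj_power)+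
  have nz': "cnj r1 \<noteq> 0" "cnj r2 \<noteq> 0" and le': "cmod (cnj r1) \<le> 1" "cmod (cnj r2) \<le> 1"
    using nz le by simp_all
  have plus: "((\<lambda>k. cnj (green b1 b2 r1 r2 n k) * \<phi> k) has_sum R_op 1 b1 b2 \<omega> \<phi> n) Zstar"
    unfolding green_cnj[symmetric]
    by (intro has_sum_green \<phi> n sq' nz' le') (simp_all add: r1_def r2_def r_lim_eq_disc_root b' \<omega>)
  have minus: "((\<lambda>k. green b1 b2 r1 r2 n k * \<phi> k) has_sum R_op (-1) b1 b2 \<omega> \<phi> n) Zstar"
    by (intro has_sum_green \<phi> n sq nz le) (simp_all add: r1_def r2_def r_lim_eq_disc_root b' \<omega>)
  have "((\<lambda>k. cnj (green b1 b2 r1 r2 n k) * \<phi> k + (- 1) * (green b1 b2 r1 r2 n k * \<phi> k)) has_sum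
      R_op 1 b1 b2 \<omega> \<phi> n + (- 1) * R_op (-1) b1 b2 \<omega> \<phi> n) Zstar"
    by (intro has_sum_add has_sum_cmult_right plus minus)
  then have "((\<lambda>k. resolvent_jump b1 b2 \<omega> n k * \<phi> k) has_sum
      R_op 1 b1 b2 \<omega> \<phi> n - R_op (-1) b1 b2 \<omega> \<phi> n) Zstar"
    by (simp add: resolvent_jump_def resolvent_def r1_def r2_def algebra_simps)
  from has_sum_unique[OF this has_sum_spectral_density[OF b \<phi> \<omega>(1)]] show ?thesis .
qed

lemma has_sum_finite_sum:
  fixes f :: "'i \<Rightarrow> 'a \<Rightarrow> 'b::topological_comm_monoid_add"
  assumes "finite I" "\<And>i. i \<in> I \<Longrightarrow> (f i has_sum S i) A"
  shows "((\<lambda>x. \<Sum>i\<in>I. f i x) has_sum (\<Sum>i\<in>I. S i)) A"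
  using assms by (induction I rule: finite_induct) (auto intro: has_sum_add)

lemma A_seq_cong:
  assumes "\<And>j. j \<noteq> 0 \<Longrightarrow> f j = g j"
  shows "A_seq b1 b2 f n = A_seq b1 b2 g n"
  using assms by (simp add: A_seq_def)

text \<open>
In this form \<open>A\<close> visibly commutes with convergent sums and with integrals.
\<close>

lemma A_seq_finite_range:
  "\<exists>c. \<forall>f. A_seq b1 b2 f n = (\<Sum>d\<in>{-2..2}. c d * f (n + d))"
proof -
  have D: "{-2..2::int} = {-2, -1, 0, 1, 2}" by auto
  define p q c where "p = complex_of_real (1 / b1\<^sup>2)" and "q = complex_of_real (1 / b2\<^sup>2)"
    and "c = complex_of_real (1 / (b1\<^sup>2 + b2\<^sup>2))"
  note A = A_seq_def of_real_add p_def[symmetric] q_def[symmetric] c_def[symmetric]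
  consider "n \<le> -2" | "n = -1" | "n = 0" | "n = 1" | "2 \<le> n" by linarith
  then show ?thesis
  proof cases
    case 1
    then show ?thesis unfolding D A
      by (intro exI[of _ "(\<lambda>_. 0)(-1 := p, 0 := - 2 * p, 1 := p)"]) (simp add: algebra_simps)
  next
    case 2
    then show ?thesis unfolding D A
      by (intro exI[of _ "(\<lambda>_. 0)(-1 := p, 0 := - (p + c), 2 := c)"]) (simp add: algebra_simps)
  next
    case 3
    then show ?thesis unfolding D A by (intro exI[of _ "\<lambda>_. 0"]) simp
  next
    case 4
    then show ?thesis unfolding D A
      by (intro exI[of _ "(\<lambda>_. 0)(-2 := c, 0 := - (c + q), 1 := q)"]) (simp add: algebra_simps)
  next
    case 5
    then show ?thesis unfolding D A
      by (intro exI[of _ "(\<lambda>_. 0)(-1 := q, 0 := - 2 * q, 1 := q)"]) (simp add: algebra_simps)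
  qed
qed

lemma A_seq_cnj: "A_seq b1 b2 (\<lambda>j. cnj (f j)) n = cnj (A_seq b1 b2 f n)"
  by (simp add: A_seq_def)

lemma A_seq_diff: "A_seq b1 b2 (\<lambda>j. f j - g j) n = A_seq b1 b2 f n - A_seq b1 b2 g n"
  by (simp add: A_seq_def algebra_simps diff_divide_distrib add_divide_distrib)

lemma A_seq_cmult: "A_seq b1 b2 (\<lambda>j. c * f j) n = c * A_seq b1 b2 f n"
  by (simp add: A_seq_def algebra_simps)

text \<open>
The point sources of the two boundary values cancel in their difference, which is therefore a generalised
eigenfunction.
\<close>

lemma A_seq_spectral_density:
  assumes b: "0 < b1" "0 < b2" and \<phi>: "(\<lambda>k. cmod (\<phi> k)) summable_on Zstar" and n: "n \<noteq> 0"
    and \<omega>: "\<omega> \<noteq> 0" "\<omega> \<noteq> - 4 / b1\<^sup>2" "\<omega> \<noteq> - 4 / b2\<^sup>2"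
  shows "A_seq b1 b2 (spectral_density b1 b2 \<phi> \<omega>) n = of_real \<omega> * spectral_density b1 b2 \<phi> \<omega> n"
proof -
  obtain c where c: "\<And>f. A_seq b1 b2 f n = (\<Sum>d\<in>{-2..2}. c d * f (n + d))"
    using A_seq_finite_range[of b1 b2 n] by blast
  have \<omega>': "complex_of_real \<omega> \<noteq> 0" "complex_of_real \<omega> \<noteq> of_real (- 4 / b1\<^sup>2)"
    "complex_of_real \<omega> \<noteq> of_real (- 4 / b2\<^sup>2)"
    by (simp_all only: of_real_eq_iff of_real_eq_0_iff \<omega> not_False_eq_True)
  have eig: "A_seq b1 b2 (\<lambda>j. resolvent_jump b1 b2 \<omega> j k) n = of_real \<omega> * resolvent_jump b1 b2 \<omega> n k" if "k \<noteq> 0" for k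
  proof -
    have "A_seq b1 b2 (\<lambda>j. resolvent b1 b2 (of_real \<omega>) j k) n
        = of_real \<omega> * resolvent b1 b2 (of_real \<omega>) n k + (if n = k then 1 else 0)"
      by (intro A_seq_resolvent b \<omega>' n that) simp
    then show ?thesis
      unfolding resolvent_jump_def A_seq_diff A_seq_cnj by (simp add: algebra_simps)
  qed
  have "((\<lambda>k. \<Sum>d\<in>{-2..2}. c d * (resolvent_jump b1 b2 \<omega> (n + d) k * \<phi> k)) has_sum
      (\<Sum>d\<in>{-2..2}. c d * spectral_density b1 b2 \<phi> \<omega> (n + d))) Zstar"
    by (intro has_sum_finite_sum has_sum_cmult_right has_sum_spectral_density b \<phi> \<omega>) simp
  also have "(\<Sum>d\<in>{-2..2}. c d * spectral_density b1 b2 \<phi> \<omega> (n + d)) = A_seq b1 b2 (spectral_density b1 b2 \<phi> \<omega>) n"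
    by (rule c[symmetric])
  finally have "((\<lambda>k. \<Sum>d\<in>{-2..2}. c d * (resolvent_jump b1 b2 \<omega> (n + d) k * \<phi> k)) has_sum
      A_seq b1 b2 (spectral_density b1 b2 \<phi> \<omega>) n) Zstar" .
  moreover have "(\<Sum>d\<in>{-2..2}. c d * (resolvent_jump b1 b2 \<omega> (n + d) k * \<phi> k))
      = of_real \<omega> * (resolvent_jump b1 b2 \<omega> n k * \<phi> k)" if "k \<in> Zstar" for k
  proof -
    have "(\<Sum>d\<in>{-2..2}. c d * (resolvent_jump b1 b2 \<omega> (n + d) k * \<phi> k))
        = (\<Sum>d\<in>{-2..2}. c d * resolvent_jump b1 b2 \<omega> (n + d) k) * \<phi> k"
      by (simp add: sum_distrib_right mult.assoc)
    also have "(\<Sum>d\<in>{-2..2}. c d * resolvent_jump b1 b2 \<omega> (n + d) k) = of_real \<omega> * resolvent_jump b1 b2 \<omega> n k"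
      using eig[of k] that by (simp add: c)
    finally show ?thesis by (simp add: mult.assoc)
  qed
  ultimately have "((\<lambda>k. of_real \<omega> * (resolvent_jump b1 b2 \<omega> n k * \<phi> k)) has_sum
      A_seq b1 b2 (spectral_density b1 b2 \<phi> \<omega>) n) Zstar"
    by (rule has_sum_cong[THEN iffD1, rotated])
  moreover have "((\<lambda>k. of_real \<omega> * (resolvent_jump b1 b2 \<omega> n k * \<phi> k)) has_sum
      of_real \<omega> * spectral_density b1 b2 \<phi> \<omega> n) Zstar"
    by (intro has_sum_cmult_right has_sum_spectral_density b \<phi> \<omega>)
  ultimately show ?thesis by (rule has_sum_unique)
qed

section \<open>Moments of the spectral_density and the exponential\<close>

lemma set_integrable_resolvent_jump:
  assumes b: "0 < b1" "0 < b2"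
  shows "set_integrable lborel (I_set b1 b2) (\<lambda>\<omega>. resolvent_jump b1 b2 \<omega> n k)"
proof -
  obtain L where L: "I_set b1 b2 \<subseteq> {- L..L}" using I_set_subset by blast
  have res: "set_integrable lborel (I_set b1 b2) (\<lambda>\<omega>. resolvent b1 b2 (of_real \<omega>) n k)"
    by (rule set_integrable_subset[OF set_integrable_resolvent[OF b] _ L]) (simp add: I_set_def)
  then have "integrable lborel (\<lambda>\<omega>. cnj (indicator (I_set b1 b2) \<omega> *\<^sub>R resolvent b1 b2 (of_real \<omega>) n k))"
    unfolding set_integrable_def complex_integrable_cnj .
  then have "set_integrable lborel (I_set b1 b2) (\<lambda>\<omega>. cnj (resolvent b1 b2 (of_real \<omega>) n k))"
    unfolding set_integrable_def complex_cnj_scaleR .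
  from set_integral_diff(1)[OF this res] show ?thesis unfolding resolvent_jump_def .
qed

lemma integral_resolvent_jump:
  assumes b: "0 < b1" "0 < b2" and nk: "n \<noteq> 0" "k \<noteq> 0"
  shows "(LINT \<omega>:I_set b1 b2|lborel. resolvent_jump b1 b2 \<omega> n k) = (if n = k then 2 * \<i> * of_real pi else 0)"
proof -
  have "resolvent_jump b1 b2 \<omega> n k = of_real (Im (resolvent b1 b2 (of_real \<omega>) n k)) * (- 2 * \<i>)" for \<omega>
    by (simp add: resolvent_jump_def complex_eq_iff)
  then have "(LINT \<omega>:I_set b1 b2|lborel. resolvent_jump b1 b2 \<omega> n k)
      = (LINT \<omega>:I_set b1 b2|lborel. of_real (Im (resolvent b1 b2 (of_real \<omega>) n k))) * (- 2 * \<i>)"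
    by (simp only: set_integral_mult_left)
  also have "(LINT \<omega>:I_set b1 b2|lborel. complex_of_real (Im (resolvent b1 b2 (of_real \<omega>) n k)))
      = of_real (LINT \<omega>:I_set b1 b2|lborel. Im (resolvent b1 b2 (of_real \<omega>) n k))"
    by (rule set_integral_complex_of_real)
  finally show ?thesis using integral_Im_resolvent[OF assms] by simp
qed

text \<open>
The sums over \<open>|k| \<le> N\<close> are dominated by an integrable function because the bound of the kernel is uniform in \<open>k\<close>;
each of them is integrated term by term by completeness.
\<close>

lemma integral_spectral_density:
  assumes b: "0 < b1" "0 < b2" and \<phi>: "(\<lambda>k. cmod (\<phi> k)) summable_on Zstar"
  shows "set_integrable lborel (I_set b1 b2) (\<lambda>\<omega>. spectral_density b1 b2 \<phi> \<omega> n)"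
    and "n \<noteq> 0 \<Longrightarrow> (LINT \<omega>:I_set b1 b2|lborel. spectral_density b1 b2 \<phi> \<omega> n) = 2 * \<i> * of_real pi * \<phi> n"
proof -
  define F :: "nat \<Rightarrow> int set" where "F = (\<lambda>N. {- int N..int N} \<inter> Zstar)"
  have F: "filterlim F (finite_subsets_at_top Zstar) sequentially"
    unfolding filterlim_finite_subsets_at_top
  proof (intro allI impI)
    fix X :: "int set" assume X: "finite X \<and> X \<subseteq> Zstar"
    then have m: "\<bar>x\<bar> \<le> (\<Sum>y\<in>X. \<bar>y\<bar>)" if "x \<in> X" for x
      using that by (intro member_le_sum) auto
    show "\<forall>\<^sub>F N in sequentially. finite (F N) \<and> X \<subseteq> F N \<and> F N \<subseteq> Zstar"
      using eventually_ge_at_top[of "nat (\<Sum>y\<in>X. \<bar>y\<bar>)"]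
      by eventually_elim (use X m in \<open>force simp: F_def\<close>)
  qed
  obtain M where M: "0 \<le> M" "\<And>\<omega> k. \<omega> \<noteq> 0 \<Longrightarrow> cmod (resolvent_jump b1 b2 \<omega> n k) \<le> M * (1 + 1 / sqrt \<bar>\<omega>\<bar>)"
    using resolvent_jump_bound[OF b, of n] by blast
  obtain L where L: "I_set b1 b2 \<subseteq> {- L..L}" using I_set_subset by blast
  define B where "B = (\<Sum>\<^sub>\<infinity>k\<in>Zstar. cmod (\<phi> k))"
  define w where "w = (\<lambda>\<omega>. indicator (I_set b1 b2) \<omega> *\<^sub>R (M * B * (1 + 1 / sqrt \<bar>\<omega>\<bar>)))"
  have "set_integrable lborel (I_set b1 b2) (\<lambda>\<omega>. M * B * (1 + 1 / sqrt \<bar>\<omega>\<bar>))"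
  proof (rule set_integrable_subset[OF _ _ L])
    show "set_integrable lborel {- L..L} (\<lambda>\<omega>. M * B * (1 + 1 / sqrt \<bar>\<omega>\<bar>))"
      using integrable_inverse_sqrt_abs[of L] by (intro set_integrable_mult_right set_integral_add(1))
        (auto intro: borel_integrable_atLeastAtMost' continuous_intros)
  qed (simp add: I_set_def)
  then have w: "integrable lborel w" by (simp add: w_def set_integrable_def)
  define s where "s = (\<lambda>N \<omega>. \<Sum>k\<in>F N. (indicator (I_set b1 b2) \<omega> *\<^sub>R resolvent_jump b1 b2 \<omega> n k) * \<phi> k)"
  define g where "g = (\<lambda>\<omega>. indicator (I_set b1 b2) \<omega> *\<^sub>R spectral_density b1 b2 \<phi> \<omega> n)"
  have resolvent_jump: "integrable lborel (\<lambda>\<omega>. indicator (I_set b1 b2) \<omega> *\<^sub>R resolvent_jump b1 b2 \<omega> n k)" for k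
    using set_integrable_resolvent_jump[OF b] unfolding set_integrable_def .
  have s_int: "integrable lborel (s N)" for N 
    unfolding s_def by (intro Bochner_Integration.integrable_sum integrable_mult_left resolvent_jump)
  then have s[measurable]: "s N \<in> borel_measurable lborel" for N by (rule borel_measurable_integrable)
  have lim: "(\<lambda>N. s N \<omega>) \<longlonglongrightarrow> g \<omega>" if "\<omega> \<noteq> 0" for \<omega>
  proof -
    have "(\<lambda>N. \<Sum>k\<in>F N. resolvent_jump b1 b2 \<omega> n k * \<phi> k) \<longlonglongrightarrow> spectral_density b1 b2 \<phi> \<omega> n"
      using has_sum_spectral_density[OF b \<phi> that, of n] unfolding has_sum_def
      by (rule filterlim_compose[OF _ F])
    then have "(\<lambda>N. indicator (I_set b1 b2) \<omega> *\<^sub>R (\<Sum>k\<in>F N. resolvent_jump b1 b2 \<omega> n k * \<phi> k)) \<longlonglongrightarrow> g \<omega>"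
      unfolding g_def by (intro tendsto_intros)
    then show ?thesis by (simp add: s_def scaleR_sum_right)
  qed
  have g[measurable]: "g \<in> borel_measurable lborel"
  proof (rule measurable_discrete_difference[where X = "{0}"])
    show "(\<lambda>\<omega>. if \<omega> = 0 then 0 else g \<omega>) \<in> borel_measurable lborel"
    proof (rule borel_measurable_LIMSEQ_metric)
      show "(\<lambda>\<omega>. if \<omega> = 0 then 0 else s N \<omega>) \<in> borel_measurable lborel" for N by measurable
      show "(\<lambda>N. if \<omega> = 0 then 0 else s N \<omega>) \<longlonglongrightarrow> (if \<omega> = 0 then 0 else g \<omega>)" for \<omega>
        using lim[of \<omega>] by auto
    qed
  qed auto
  have bnd: "norm (s N \<omega>) \<le> w \<omega>" if "\<omega> \<noteq> 0" for N \<omega>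
  proof -
    have "norm (s N \<omega>) \<le> (\<Sum>k\<in>F N. indicator (I_set b1 b2) \<omega> * (M * (1 + 1 / sqrt \<bar>\<omega>\<bar>)) * cmod (\<phi> k))"
      unfolding s_def using M(2)[OF that]
      by (intro sum_norm_le) (auto simp: norm_mult indicator_def intro!: mult_right_mono)
    also have "\<dots> = indicator (I_set b1 b2) \<omega> * (M * (1 + 1 / sqrt \<bar>\<omega>\<bar>)) * (\<Sum>k\<in>F N. cmod (\<phi> k))"
      by (simp add: sum_distrib_left)
    also have "\<dots> \<le> indicator (I_set b1 b2) \<omega> * (M * (1 + 1 / sqrt \<bar>\<omega>\<bar>)) * B"
      unfolding B_def using M(1) \<phi>
      by (intro mult_left_mono finite_sum_le_infsum) (auto simp: F_def)
    finally show ?thesis by (simp add: w_def mult_ac)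
  qed
  have ae: "AE \<omega> in lborel. \<omega> \<noteq> (0::real)" by (rule AE_lborel_singleton)
  have lim': "AE \<omega> in lborel. (\<lambda>N. s N \<omega>) \<longlonglongrightarrow> g \<omega>" using ae by eventually_elim (rule lim)
  have bnd': "AE \<omega> in lborel. norm (s N \<omega>) \<le> w \<omega>" for N using ae by eventually_elim (rule bnd)
  show "set_integrable lborel (I_set b1 b2) (\<lambda>\<omega>. spectral_density b1 b2 \<phi> \<omega> n)"
    using integrable_dominated_convergence[OF g s w lim' bnd'] by (simp add: set_integrable_def g_def)
  assume n: "n \<noteq> 0"
  have "(\<lambda>N. integral\<^sup>L lborel (s N)) \<longlonglongrightarrow> integral\<^sup>L lborel g"
    by (rule integral_dominated_convergence[OF g s w lim' bnd'])
  moreover have "\<forall>\<^sub>F N in sequentially. integral\<^sup>L lborel (s N) = 2 * \<i> * of_real pi * \<phi> n"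
    using eventually_ge_at_top[of "nat \<bar>n\<bar>"]
  proof eventually_elim
    fix N assume N: "nat \<bar>n\<bar> \<le> N"
    have "integral\<^sup>L lborel (s N)
        = (\<Sum>k\<in>F N. LINT \<omega>|lborel. (indicator (I_set b1 b2) \<omega> *\<^sub>R resolvent_jump b1 b2 \<omega> n k) * \<phi> k)"
      unfolding s_def by (intro Bochner_Integration.integral_sum integrable_mult_left resolvent_jump)
    also have "\<dots> = (\<Sum>k\<in>F N. (LINT \<omega>:I_set b1 b2|lborel. resolvent_jump b1 b2 \<omega> n k) * \<phi> k)"
      unfolding set_lebesgue_integral_def by (simp only: integral_mult_left_zero)
    also have "\<dots> = (\<Sum>k\<in>F N. if n = k then 2 * \<i> * of_real pi * \<phi> k else 0)"
      by (intro sum.cong refl) (use n in \<open>auto simp: integral_resolvent_jump[OF b] F_def\<close>)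
    also have "\<dots> = 2 * \<i> * of_real pi * \<phi> n"
      using N n by (subst sum.delta') (auto simp: F_def)
    finally show "integral\<^sup>L lborel (s N) = 2 * \<i> * of_real pi * \<phi> n" .
  qed
  then have "(\<lambda>N. integral\<^sup>L lborel (s N)) \<longlonglongrightarrow> 2 * \<i> * of_real pi * \<phi> n"
    by (rule tendsto_eventually)
  ultimately show "(LINT \<omega>:I_set b1 b2|lborel. spectral_density b1 b2 \<phi> \<omega> n) = 2 * \<i> * of_real pi * \<phi> n"
    using LIMSEQ_unique unfolding set_lebesgue_integral_def g_def by blast
qed

lemma set_integrable_bounded_mult:
  fixes f g :: "real \<Rightarrow> complex"
  assumes f: "set_integrable lborel S f" and g: "continuous_on UNIV g"
    and B: "\<And>x. x \<in> S \<Longrightarrow> cmod (g x) \<le> B"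
  shows "set_integrable lborel S (\<lambda>x. g x * f x)"
  unfolding set_integrable_def
proof (rule Bochner_Integration.integrable_bound)
  have f': "integrable lborel (\<lambda>x. indicator S x *\<^sub>R f x)" using f unfolding set_integrable_def .
  then show "integrable lborel (\<lambda>x. B *\<^sub>R norm (indicator S x *\<^sub>R f x))" by (intro integrable_scaleR_right integrable_norm)
  have [measurable]: "g \<in> borel_measurable lborel"
    using borel_measurable_continuous_onI[OF g] by simp
  have [measurable]: "(\<lambda>x. indicator S x *\<^sub>R f x) \<in> borel_measurable lborel"
    using f' by (rule borel_measurable_integrable)
  have "(\<lambda>x. g x * (indicator S x *\<^sub>R f x)) \<in> borel_measurable lborel" by measurable
  then show "(\<lambda>x. indicator S x *\<^sub>R (g x * f x)) \<in> borel_measurable lborel" by simp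
  show "AE x in lborel. norm (indicator S x *\<^sub>R (g x * f x)) \<le> norm (B *\<^sub>R norm (indicator S x *\<^sub>R f x))"
  proof (rule AE_I2)
    fix x
    have "cmod (g x * f x) \<le> \<bar>B\<bar> * cmod (f x)" if "x \<in> S"
      unfolding norm_mult using B[OF that] by (intro mult_right_mono) auto
    then show "norm (indicator S x *\<^sub>R (g x * f x)) \<le> norm (B *\<^sub>R norm (indicator S x *\<^sub>R f x))"
      by (auto simp: indicator_def)
  qed
qed

lemma set_integral_finite_sum:
  fixes f :: "'i \<Rightarrow> 'a \<Rightarrow> 'b::{banach, second_countable_topology}"
  assumes "\<And>i. i \<in> I \<Longrightarrow> set_integrable M S (f i)"
  shows "(LINT x:S|M. \<Sum>i\<in>I. f i x) = (\<Sum>i\<in>I. LINT x:S|M. f i x)"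
  using assms unfolding set_lebesgue_integral_def set_integrable_def scaleR_sum_right
  by (rule Bochner_Integration.integral_sum)

lemma set_integral_cong_off_finite:
  fixes f g :: "real \<Rightarrow> complex"
  assumes "finite X" "\<And>x. x \<notin> X \<Longrightarrow> f x = g x"
  shows "set_integrable lborel S f \<longleftrightarrow> set_integrable lborel S g"
    and "(LINT x:S|lborel. f x) = (LINT x:S|lborel. g x)"
  unfolding set_integrable_def set_lebesgue_integral_def
  by (rule integrable_discrete_difference[where X = X] integral_discrete_difference[where X = X];
      use assms in \<open>auto intro: countable_finite\<close>)+

text \<open>
Completeness is the case \<open>m = 0\<close>; in the induction step a factor \<open>\<omega>\<close> is traded for an application of \<open>A\<close>.
\<close>

lemma moment_spectral_density:
  assumes b: "0 < b1" "0 < b2" and \<phi>: "(\<lambda>k. cmod (\<phi> k)) summable_on Zstar" and n: "n \<noteq> 0"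
  shows "(LINT \<omega>:I_set b1 b2|lborel. of_real \<omega> ^ m * spectral_density b1 b2 \<phi> \<omega> n)
    = 2 * \<i> * of_real pi * (A_seq b1 b2 ^^ m) \<phi> n"
  using n
proof (induction m arbitrary: n)
  case 0
  then show ?case using integral_spectral_density(2)[OF b \<phi>] by simp
next
  case (Suc m)
  define J where "J = (\<lambda>n. LINT \<omega>:I_set b1 b2|lborel. of_real \<omega> ^ m * spectral_density b1 b2 \<phi> \<omega> n)"
  obtain L where L: "0 \<le> L" "I_set b1 b2 \<subseteq> {- L..L}" using I_set_subset by blast
  have absL: "\<bar>\<omega>\<bar> \<le> L" if "\<omega> \<in> I_set b1 b2" for \<omega>
    using subsetD[OF L(2) that] by (auto simp: abs_le_iff)
  have int: "set_integrable lborel (I_set b1 b2) (\<lambda>\<omega>. of_real \<omega> ^ m * spectral_density b1 b2 \<phi> \<omega> j)" for j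
  proof (rule set_integrable_bounded_mult[OF integral_spectral_density(1)[OF b \<phi>]])
    show "cmod (of_real \<omega> ^ m) \<le> L ^ m" if "\<omega> \<in> I_set b1 b2" for \<omega>
      using absL[OF that] by (auto simp: norm_power intro!: power_mono)
  qed (intro continuous_intros)
  obtain c where c: "\<And>f. A_seq b1 b2 f n = (\<Sum>d\<in>{-2..2}. c d * f (n + d))"
    using A_seq_finite_range[of b1 b2 n] by blast
  have "(LINT \<omega>:I_set b1 b2|lborel. of_real \<omega> ^ Suc m * spectral_density b1 b2 \<phi> \<omega> n)
      = (LINT \<omega>:I_set b1 b2|lborel. \<Sum>d\<in>{-2..2}. c d * (of_real \<omega> ^ m * spectral_density b1 b2 \<phi> \<omega> (n + d)))"
  proof (rule set_integral_cong_off_finite(2)[of "{0, - 4 / b1\<^sup>2, - 4 / b2\<^sup>2}"])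
    fix \<omega> assume "\<omega> \<notin> {0, - 4 / b1\<^sup>2, - 4 / b2\<^sup>2}"
    then have "of_real \<omega> * spectral_density b1 b2 \<phi> \<omega> n = A_seq b1 b2 (spectral_density b1 b2 \<phi> \<omega>) n"
      using A_seq_spectral_density[OF b \<phi> Suc.prems, of \<omega>] by simp
    also have "\<dots> = (\<Sum>d\<in>{-2..2}. c d * spectral_density b1 b2 \<phi> \<omega> (n + d))" by (rule c)
    finally have "of_real \<omega> ^ m * (of_real \<omega> * spectral_density b1 b2 \<phi> \<omega> n)
        = of_real \<omega> ^ m * (\<Sum>d\<in>{-2..2}. c d * spectral_density b1 b2 \<phi> \<omega> (n + d))" by simp
    then show "of_real \<omega> ^ Suc m * spectral_density b1 b2 \<phi> \<omega> n
        = (\<Sum>d\<in>{-2..2}. c d * (of_real \<omega> ^ m * spectral_density b1 b2 \<phi> \<omega> (n + d)))"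
      by (simp add: sum_distrib_left mult_ac)
  qed simp
  also have "\<dots> = (\<Sum>d\<in>{-2..2}. LINT \<omega>:I_set b1 b2|lborel. c d * (of_real \<omega> ^ m * spectral_density b1 b2 \<phi> \<omega> (n + d)))"
    by (rule set_integral_finite_sum) (auto intro: set_integrable_mult_right int)
  also have "\<dots> = (\<Sum>d\<in>{-2..2}. c d * J (n + d))" by (simp add: J_def)
  also have "\<dots> = A_seq b1 b2 J n" by (rule c[symmetric])
  also have "\<dots> = A_seq b1 b2 (\<lambda>j. 2 * \<i> * of_real pi * (A_seq b1 b2 ^^ m) \<phi> j) n"
    unfolding J_def by (rule A_seq_cong) (rule Suc.IH)
  also have "\<dots> = 2 * \<i> * of_real pi * (A_seq b1 b2 ^^ Suc m) \<phi> n"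
    by (simp only: A_seq_cmult funpow.simps o_def)
  finally show ?case .
qed

text \<open>
The partial sums of the exponential series are uniformly bounded on the bounded set of integration.
\<close>

lemma exp_spectral_density_sums:
  assumes b: "0 < b1" "0 < b2" and \<phi>: "(\<lambda>k. cmod (\<phi> k)) summable_on Zstar" and n: "n \<noteq> 0"
  shows "set_integrable lborel (I_set b1 b2) (\<lambda>\<omega>. exp (\<i> * of_real (t * \<omega>)) * spectral_density b1 b2 \<phi> \<omega> n)"
    and "(\<lambda>m. (\<i> * of_real t) ^ m / fact m * (2 * \<i> * of_real pi * (A_seq b1 b2 ^^ m) \<phi> n)) sums
      (LINT \<omega>:I_set b1 b2|lborel. exp (\<i> * of_real (t * \<omega>)) * spectral_density b1 b2 \<phi> \<omega> n)"
proof -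
  let ?I = "I_set b1 b2"
  define W where "W = (\<lambda>\<omega>. spectral_density b1 b2 \<phi> \<omega> n)"
  define z where "z = (\<lambda>\<omega>. \<i> * of_real (t * \<omega>))"
  obtain L where L: "0 \<le> L" "?I \<subseteq> {- L..L}" using I_set_subset by blast
  have absL: "\<bar>\<omega>\<bar> \<le> L" if "\<omega> \<in> ?I" for \<omega>
    using subsetD[OF L(2) that] by (auto simp: abs_le_iff)
  have W: "set_integrable lborel ?I W" unfolding W_def by (rule integral_spectral_density(1)[OF b \<phi>])
  have z: "cmod (z \<omega>) \<le> \<bar>t\<bar> * L" if "\<omega> \<in> ?I" for \<omega>
    using absL[OF that] by (auto simp: z_def norm_mult abs_mult intro!: mult_left_mono)
  have cont: "continuous_on UNIV z" unfolding z_def by (intro continuous_intros)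
  have expz: "cmod (exp (z \<omega>)) \<le> 1" for \<omega> by (simp add: z_def)
  show int_exp: "set_integrable lborel ?I (\<lambda>\<omega>. exp (\<i> * of_real (t * \<omega>)) * spectral_density b1 b2 \<phi> \<omega> n)"
    using set_integrable_bounded_mult[OF W continuous_on_exp[OF cont] expz] unfolding W_def z_def .
  define p where "p = (\<lambda>N \<omega>. \<Sum>m<N. z \<omega> ^ m / fact m)"
  have p_bound: "cmod (p N \<omega>) \<le> exp (\<bar>t\<bar> * L)" if "\<omega> \<in> ?I" for N \<omega>
  proof -
    have "cmod (p N \<omega>) \<le> (\<Sum>m<N. cmod (z \<omega>) ^ m /\<^sub>R fact m)"
      unfolding p_def by (intro sum_norm_le) (simp add: norm_mult norm_inverse norm_power divide_inverse mult.commute)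
    also have "\<dots> \<le> exp (cmod (z \<omega>))"
      unfolding exp_def by (intro sum_le_suminf summable_exp_generic) auto
    also have "\<dots> \<le> exp (\<bar>t\<bar> * L)" using z[OF that] by simp
    finally show ?thesis .
  qed
  have p_cont: "continuous_on UNIV (p N)" for N
    unfolding p_def using cont by (intro continuous_intros) auto
  define s where "s = (\<lambda>N \<omega>. indicator ?I \<omega> *\<^sub>R (p N \<omega> * W \<omega>))"
  define g where "g = (\<lambda>\<omega>. indicator ?I \<omega> *\<^sub>R (exp (z \<omega>) * W \<omega>))"
  define w where "w = (\<lambda>\<omega>. exp (\<bar>t\<bar> * L) * norm (indicator ?I \<omega> *\<^sub>R W \<omega>))"
  have "integrable lborel g" using int_exp unfolding set_integrable_def g_def z_def W_def .
  then have g: "g \<in> borel_measurable lborel" by (rule borel_measurable_integrable)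
  have "integrable lborel (s N)" for N
    using set_integrable_bounded_mult[OF W p_cont p_bound] unfolding set_integrable_def s_def .
  then have s: "s N \<in> borel_measurable lborel" for N by (rule borel_measurable_integrable)
  have w: "integrable lborel w"
    using W unfolding set_integrable_def w_def by (intro integrable_mult_right integrable_norm)
  have bnd: "AE \<omega> in lborel. norm (s N \<omega>) \<le> w \<omega>" for N
  proof (rule AE_I2)
    fix \<omega> show "norm (s N \<omega>) \<le> w \<omega>"
      using p_bound[of \<omega> N] by (auto simp: s_def w_def indicator_def norm_mult intro!: mult_right_mono)
  qed
  have lim: "AE \<omega> in lborel. (\<lambda>N. s N \<omega>) \<longlonglongrightarrow> g \<omega>"
  proof (rule AE_I2)
    fix \<omega>
    have "(\<lambda>m. z \<omega> ^ m / fact m) sums exp (z \<omega>)"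
      using exp_converges[of "z \<omega>"] by (simp add: scaleR_conv_of_real divide_inverse mult.commute)
    then have "(\<lambda>N. p N \<omega>) \<longlonglongrightarrow> exp (z \<omega>)" unfolding sums_def p_def .
    then show "(\<lambda>N. s N \<omega>) \<longlonglongrightarrow> g \<omega>" unfolding s_def g_def by (intro tendsto_intros)
  qed
  have "(\<lambda>N. integral\<^sup>L lborel (s N)) \<longlonglongrightarrow> integral\<^sup>L lborel g"
    by (rule integral_dominated_convergence[OF g s w lim bnd])
  moreover have "integral\<^sup>L lborel (s N)
      = (\<Sum>m<N. (\<i> * of_real t) ^ m / fact m * (2 * \<i> * of_real pi * (A_seq b1 b2 ^^ m) \<phi> n))" for N
  proof -
    have pow: "set_integrable lborel ?I (\<lambda>\<omega>. of_real \<omega> ^ m * W \<omega>)" for m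
    proof (rule set_integrable_bounded_mult[OF W])
      show "cmod (of_real \<omega> ^ m) \<le> L ^ m" if "\<omega> \<in> ?I" for \<omega>
        using absL[OF that] by (auto simp: norm_power intro!: power_mono)
    qed (intro continuous_intros)
    have "integral\<^sup>L lborel (s N) = (LINT \<omega>:?I|lborel. p N \<omega> * W \<omega>)"
      by (simp add: s_def set_lebesgue_integral_def)
    also have "(\<lambda>\<omega>. p N \<omega> * W \<omega>)
        = (\<lambda>\<omega>. \<Sum>m<N. (\<i> * of_real t) ^ m / fact m * (of_real \<omega> ^ m * W \<omega>))"
      unfolding p_def z_def sum_distrib_right
      by (intro ext sum.cong refl) (simp add: power_mult_distrib)
    also have "(LINT \<omega>:?I|lborel. \<Sum>m<N. (\<i> * of_real t) ^ m / fact m * (of_real \<omega> ^ m * W \<omega>))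
        = (\<Sum>m<N. LINT \<omega>:?I|lborel. (\<i> * of_real t) ^ m / fact m * (of_real \<omega> ^ m * W \<omega>))"
      by (rule set_integral_finite_sum) (auto intro: set_integrable_mult_right pow)
    also have "\<dots> = (\<Sum>m<N. (\<i> * of_real t) ^ m / fact m * (LINT \<omega>:?I|lborel. of_real \<omega> ^ m * W \<omega>))"
      by (simp only: set_integral_mult_right)
    finally show ?thesis unfolding W_def by (simp only: moment_spectral_density[OF b \<phi> n])
  qed
  ultimately show "(\<lambda>m. (\<i> * of_real t) ^ m / fact m * (2 * \<i> * of_real pi * (A_seq b1 b2 ^^ m) \<phi> n)) sums
      (LINT \<omega>:?I|lborel. exp (\<i> * of_real (t * \<omega>)) * spectral_density b1 b2 \<phi> \<omega> n)"
    unfolding sums_def by (simp add: g_def set_lebesgue_integral_def z_def W_def)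
qed

lemma bounded_linear_coord: "bounded_linear (\<lambda>f. coord f j)"
  by (rule bounded_linear_intro[where K = 1]) (simp_all add: cmod_coord_le scaleR_conv_of_real)

lemma coord_A_op_power:
  "coord (blinfun_apply (((o\<^sub>L) (cmult_ell2 c o\<^sub>L A_op b1 b2) ^^ m) id_blinfun) f) j
    = c ^ m * (A_seq b1 b2 ^^ m) (coord f) j"
proof (induction m arbitrary: j)
  case (Suc m)
  define y where "y = blinfun_apply (((o\<^sub>L) (cmult_ell2 c o\<^sub>L A_op b1 b2) ^^ m) id_blinfun) f"
  have "coord (blinfun_apply (((o\<^sub>L) (cmult_ell2 c o\<^sub>L A_op b1 b2) ^^ Suc m) id_blinfun) f) j
      = c * coord (blinfun_apply (A_op b1 b2) y) j"
    by (simp only: funpow.simps o_apply blinfun_apply_blinfun_compose y_def[symmetric]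
        cmult_ell2.rep_eq coord_cmult_ell2)
  also have "\<dots> = c * A_seq b1 b2 (coord y) j" by (simp only: coord_A_op)
  also have "coord y = (\<lambda>i. c ^ m * (A_seq b1 b2 ^^ m) (coord f) i)"
    unfolding y_def by (rule ext) (rule Suc.IH)
  finally show ?case by (simp add: A_seq_cmult)
qed simp

lemma coord_exp_sums:
  "(\<lambda>m. c ^ m / fact m * (A_seq b1 b2 ^^ m) (coord f) j) sums
    coord (blinfun_apply (exp_blinfun (cmult_ell2 c o\<^sub>L A_op b1 b2)) f) j"
proof -
  define T where "T = cmult_ell2 c o\<^sub>L A_op b1 b2"
  have "(\<lambda>m. (1 / fact m) *\<^sub>R (((o\<^sub>L) T ^^ m) id_blinfun)) sums exp_blinfun T"
    unfolding exp_blinfun_def by (rule summable_sums[OF summable_exp_blinfun])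
  moreover have "bounded_linear (\<lambda>B. coord (blinfun_apply B f) j)"
    by (rule bounded_linear_compose[OF bounded_linear_coord blinfun.bounded_linear_left])
  ultimately have "(\<lambda>m. coord (blinfun_apply ((1 / fact m) *\<^sub>R (((o\<^sub>L) T ^^ m) id_blinfun)) f) j) sums
      coord (blinfun_apply (exp_blinfun T) f) j"
    by (rule bounded_linear.sums[rotated])
  then show ?thesis
    by (simp add: T_def blinfun.scaleR_left coord_A_op_power)
qed

lemma A_seq_power_cong:
  assumes "\<And>j. j \<noteq> 0 \<Longrightarrow> f j = g j" "n \<noteq> 0"
  shows "(A_seq b1 b2 ^^ m) f n = (A_seq b1 b2 ^^ m) g n"
  using assms(2)
proof (induction m arbitrary: n)
  case (Suc m)
  show ?case by (simp add: A_seq_cong[OF Suc.IH])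
qed (simp add: assms(1))

theorem lemma4p4:
  fixes b1 b2 t :: real and \<phi> :: "int \<Rightarrow> complex" and n :: int
  assumes "b1 > 0" and "b2 > 0"
    and "(\<lambda>k. cmod (\<phi> k)) summable_on Zstar"
    and "n \<in> Zstar"
  shows "set_integrable lborel (I_set b1 b2)
           (\<lambda>\<omega>. exp (\<i> * of_real (t * \<omega>))
                 * (R_op 1 b1 b2 \<omega> \<phi> n - R_op (-1) b1 b2 \<omega> \<phi> n))
    \<and> coord (blinfun_apply (exp_blinfun (cmult_ell2 (\<i> * of_real t) o\<^sub>L A_op b1 b2)) (to_ell2 \<phi>)) n
        = 1 / (2 * \<i> * of_real pi)
          * (LINT \<omega>:I_set b1 b2|lborel. exp (\<i> * of_real (t * \<omega>))
               * (R_op 1 b1 b2 \<omega> \<phi> n - R_op (-1) b1 b2 \<omega> \<phi> n))"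
proof -
  note b = assms(1,2) and \<phi> = assms(3)
  have n: "n \<noteq> 0" using assms(4) by simp
  let ?R = "\<lambda>\<omega>. exp (\<i> * of_real (t * \<omega>)) * (R_op 1 b1 b2 \<omega> \<phi> n - R_op (-1) b1 b2 \<omega> \<phi> n)"
  let ?W = "\<lambda>\<omega>. exp (\<i> * of_real (t * \<omega>)) * spectral_density b1 b2 \<phi> \<omega> n"
  let ?X = "{0, - 4 / b1\<^sup>2, - 4 / b2\<^sup>2}"
  have eq: "?R \<omega> = ?W \<omega>" if "\<omega> \<notin> ?X" for \<omega>
    using R_op_difference_eq_spectral_density[OF b \<phi> n, of \<omega>] that by simp
  have pow: "(A_seq b1 b2 ^^ m) (coord (to_ell2 \<phi>)) n = (A_seq b1 b2 ^^ m) \<phi> n" for m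
    by (rule A_seq_power_cong) (use coord_to_ell2[OF \<phi>] n in auto)
  have "(\<lambda>m. 2 * \<i> * of_real pi * ((\<i> * of_real t) ^ m / fact m * (A_seq b1 b2 ^^ m) \<phi> n)) sums
      (2 * \<i> * of_real pi * coord (blinfun_apply (exp_blinfun (cmult_ell2 (\<i> * of_real t) o\<^sub>L A_op b1 b2)) (to_ell2 \<phi>)) n)"
    using coord_exp_sums[of "\<i> * of_real t" b1 b2 "to_ell2 \<phi>" n] unfolding pow by (rule sums_mult)
  moreover have "(\<lambda>m. 2 * \<i> * of_real pi * ((\<i> * of_real t) ^ m / fact m * (A_seq b1 b2 ^^ m) \<phi> n)) sums
      (LINT \<omega>:I_set b1 b2|lborel. ?W \<omega>)"
    using exp_spectral_density_sums(2)[OF b \<phi> n, of t] by (simp only: mult.left_commute)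
  ultimately have "2 * \<i> * of_real pi
      * coord (blinfun_apply (exp_blinfun (cmult_ell2 (\<i> * of_real t) o\<^sub>L A_op b1 b2)) (to_ell2 \<phi>)) n
      = (LINT \<omega>:I_set b1 b2|lborel. ?W \<omega>)"
    by (rule sums_unique2)
  moreover have "(LINT \<omega>:I_set b1 b2|lborel. ?R \<omega>) = (LINT \<omega>:I_set b1 b2|lborel. ?W \<omega>)"
    by (rule set_integral_cong_off_finite(2)[of ?X]) (use eq in auto)
  moreover have "set_integrable lborel (I_set b1 b2) ?R"
    using set_integral_cong_off_finite(1)[of ?X ?R ?W "I_set b1 b2"] eq exp_spectral_density_sums(1)[OF b \<phi> n, of t]
    by simp
  ultimately show ?thesis
    by (simp add: divide_simps mult_ac)
qed

end
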